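(* Let $A$ be a standard graded polynomial ring over a field $k$ and let $\mathfrak{m}$ be its maximal homogeneous ideal. Let $I \subseteq A$ be a homogeneous $\mathfrak{m}$-primary ideal generated by forms of degree $d > 0$, and let $\mathcal{R}=A[It]$. Then, for all $q > a^*\big(\mathcal{R}_{(a^*_\phi+1,* )}\big)$, we have $$a^*(I^q) = dq + a^*_\phi \quad\text{and}\quad \operatorname{reg}(I^q) = dq + \operatorname{reg}_\phi.$$ In particular, $$\operatorname{stab}_{\operatorname{reg}}(I) = \operatorname{stab}_a(I) \le a^*\big(\mathcal{R}_{(a^*_\phi+1,* )}\big)+1.$$ Here $\phi$, $a^*_\phi$, $\operatorname{reg}_\phi$, $\mathcal{R}_{(p,* )}$ and the stability indexes are as defined in the context.
   Context: All rings are commutative Noetherian. $a$-invariants. Let $S=\bigoplus_{n\ge 0}S_n$ be a finitely generated graded algebra over $S_0$, $S_+=\bigoplus_{n>0}S_n$, and $M$ a finitely generated graded $S$-module. Put $a^i(M)=\sup\{n\in\mathbb{Z} : [H^i_{S_+}(M)]_n\neq 0\}$ (and $a^i(M)=-\infty$ if $H^i_{S_+}(M)=0$), $a^*(M)=\max_{i\ge 0}a^i(M)$, $\operatorname{reg}(M)=\max_{i\ge 0}\{a^i(M)+i\}$. The invariants $a^*(I^q)$ and $\operatorname{reg}(I^q)$ are those of the graded $A$-module $I^q$. Setting. $I=(f_0,\dots,f_m)$ with all $f_i$ forms of degree $d$. The Rees algebra $\mathcal{R}=A[It]$ is bigraded by $\mathcal{R}_{(p,q)}=(I^q)_{p+dq}\,t^q$.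 Put $\mathcal{R}_{(p,* )}=\bigoplus_{q}\mathcal{R}_{(p,q)}$, a graded module over $B=\mathcal{R}_{(0,* )}=k[f_0t,\dots,f_mt]$, which is standard graded by $t$-degree; $a^*(\mathcal{R}_{(p,* )})$ is computed over $B$. Let $X=\operatorname{Proj}A$, $\overline{X}=\operatorname{Proj}B\subseteq\mathbb{P}^m_k$, let $\widetilde{X}\subseteq X\times\mathbb{P}^m_k$ be the bi-projective scheme of $\mathcal{R}$ (the closure of the graph of the map $[f_0:\dots:f_m]$), and let $\phi:\widetilde{X}\to\overline{X}$ be the projection onto the second coordinate. Fiber invariants. For $\mathfrak{q}\in\overline{X}$ let $\mathcal{R}_{(\mathfrak{q})}=\bigoplus_{p\ge 0}(\mathcal{R}_{(p,* )})_{(\mathfrak{q})}$ (homogeneous localization, i.e. degree-zero part of the localization at homogeneous elements of $B$ outside $\mathfrak{q}$), graded by $p$ over $B_{(\mathfrak{q})}$; then $a^*_\phi=\sup_{\mathfrak{q}\in\overline{X}}a^*(\mathcal{R}_{(\mathfrak{q})})$ and $\operatorname{reg}_\phi=\sup_{\mathfrak{q}\in\overline{X}}\operatorname{reg}(\mathcal{R}_{(\mathfrak{q})})$. Stability indexes. $\operatorname{stab}_a(I)=\min\{q_a : a^*(I^q)=dq+a^*_\phi \text{ for all } q\ge q_a\}$ and $\operatorname{stab}_{\operatorname{reg}}(I)=\min\{q_r : \operatorname{reg}(I^q)=dq+\operatorname{reg}_\phi \text{ for all } q\ge q_r\}$. Powers $I^q$ (and the candidates $q_a,q_r$) are considered for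 integers $\ge 1$; a bound of a stability index by $N$ means that the corresponding formula holds for all $q\ge 1$ with $q\ge N$. *)

theory Defs
  imports
    "HOL-Library.Poly_Mapping"
    "HOL-Library.FuncSet"
    "HOL-Library.Extended_Real"
    "HOL-Computational_Algebra.Polynomial"
    "HOL-Computational_Algebra.Fraction_Field"
begin

section \<open>Graded local cohomology\<close>

text \<open>
  A graded module is a family \<open>M :: int \<Rightarrow> 'b set\<close> of homogeneous components inside an ambient
  module \<open>'b\<close> over a commutative ring \<open>'a\<close>.  The list \<open>xs\<close> consists of elements of degree \<open>1\<close>
  of \<open>'a\<close> generating the irrelevant ideal \<open>S\<^sub>+\<close> of the standard graded ring \<open>S\<close> that acts on \<open>M\<close>.
  The local cohomology of \<open>M\<close> with support in \<open>S\<^sub>+\<close> is the cohomology of the Cech complex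
  \<open>0 \<rightarrow> M \<rightarrow> \<Oplus>\<^sub>i M\<^bsub>x\<^sub>i\<^esub> \<rightarrow> \<Oplus>\<^sub>i\<^sub><\<^sub>j M\<^bsub>x\<^sub>ix\<^sub>j\<^esub> \<rightarrow> \<dots>\<close>, with its grading.
\<close>

locale cech = module scale
  for scale :: "'a::comm_ring_1 \<Rightarrow> 'b::ab_group_add \<Rightarrow> 'b" (infixr \<open>*s\<close> 75)
begin

text \<open>
  The fraction \<open>m / x\<^sup>s\<close> in the localization of the ambient module at \<open>x\<close>, as an equivalence
  class of pairs.  No regularity of \<open>x\<close> is assumed; for \<open>x = 0\<close> there is only one class.
\<close>
definition frac :: "'a \<Rightarrow> 'b \<Rightarrow> nat \<Rightarrow> ('b \<times> nat) set" where
  "frac x m s = {(m', s'). \<exists>k. x ^ (k + s') *s m = x ^ (k + s) *s m'}"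

definition frac_add :: "'a \<Rightarrow> ('b \<times> nat) set \<Rightarrow> ('b \<times> nat) set \<Rightarrow> ('b \<times> nat) set" where
  "frac_add x F G = (\<Union>(m, s)\<in>F. \<Union>(m', s')\<in>G. frac x (x ^ s' *s m + x ^ s *s m') (s + s'))"

text \<open>
  \<open>c\<close> times the canonical map from the localization at \<open>x\<close> to the one at \<open>x * y\<close>,
  that is \<open>m / x\<^sup>s \<mapsto> c y\<^sup>s m / (x y)\<^sup>s\<close>.
\<close>
definition frac_map :: "'a \<Rightarrow> 'a \<Rightarrow> 'a \<Rightarrow> ('b \<times> nat) set \<Rightarrow> ('b \<times> nat) set" where
  "frac_map c x y F = (\<Union>(m, s)\<in>F. frac (x * y) ((c * y ^ s) *s m) s)"

text \<open>The degree \<open>n\<close> component of the localization of \<open>M\<close> at an element \<open>x\<close> of degree \<open>e\<close>.\<close>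
definition loc_comp :: "(int \<Rightarrow> 'b set) \<Rightarrow> 'a \<Rightarrow> nat \<Rightarrow> int \<Rightarrow> ('b \<times> nat) set set" where
  "loc_comp M x e n = {frac x m s | m s. m \<in> M (n + int s * int e)}"

definition cech_index :: "'a list \<Rightarrow> nat \<Rightarrow> nat set set" where
  "cech_index xs i = {J. J \<subseteq> {..<length xs} \<and> card J = i}"

definition cech_elem :: "'a list \<Rightarrow> nat set \<Rightarrow> 'a" where
  "cech_elem xs J = (\<Prod>j\<in>J. xs ! j)"

definition cech_cochains ::
    "'a list \<Rightarrow> (int \<Rightarrow> 'b set) \<Rightarrow> nat \<Rightarrow> int \<Rightarrow> (nat set \<Rightarrow> ('b \<times> nat) set) set" where
  "cech_cochains xs M i n = (\<Pi>\<^sub>E J\<in>cech_index xs i. loc_comp M (cech_elem xs J) i n)"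

definition cech_zero :: "'a list \<Rightarrow> nat \<Rightarrow> nat set \<Rightarrow> ('b \<times> nat) set" where
  "cech_zero xs i = (\<lambda>J\<in>cech_index xs i. frac (cech_elem xs J) 0 0)"

text \<open>
  The differential from cochains of degree \<open>i\<close> to cochains of degree \<open>Suc i\<close>; its value at \<open>J\<close> is
  the sum over \<open>j \<in> J\<close> of the images of \<open>c (J - {j})\<close> with sign \<open>(-1)\<^sup>p\<close>, \<open>p\<close> the position of
  \<open>j\<close> in \<open>J\<close>.
\<close>
definition cech_diff ::
    "'a list \<Rightarrow> nat \<Rightarrow> (nat set \<Rightarrow> ('b \<times> nat) set) \<Rightarrow> nat set \<Rightarrow> ('b \<times> nat) set" where
  "cech_diff xs i c = (\<lambda>J\<in>cech_index xs (Suc i).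
     foldr (\<lambda>j. frac_add (cech_elem xs J)
                  (frac_map ((-1) ^ card {k \<in> J. k < j}) (cech_elem xs (J - {j})) (xs ! j)
                    (c (J - {j}))))
           (sorted_list_of_set J) (frac (cech_elem xs J) 0 0))"

definition cech_cocycles ::
    "'a list \<Rightarrow> (int \<Rightarrow> 'b set) \<Rightarrow> nat \<Rightarrow> int \<Rightarrow> (nat set \<Rightarrow> ('b \<times> nat) set) set" where
  "cech_cocycles xs M i n =
     {c \<in> cech_cochains xs M i n. cech_diff xs i c = cech_zero xs (Suc i)}"

definition cech_coboundaries ::
    "'a list \<Rightarrow> (int \<Rightarrow> 'b set) \<Rightarrow> nat \<Rightarrow> int \<Rightarrow> (nat set \<Rightarrow> ('b \<times> nat) set) set" where
  "cech_coboundaries xs M i n =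
     (case i of 0 \<Rightarrow> {cech_zero xs 0} | Suc j \<Rightarrow> cech_diff xs j ` cech_cochains xs M j n)"

text \<open>The degree \<open>n\<close> component (cocycles modulo coboundaries) of the \<open>i\<close>-th cohomology is nonzero.\<close>
definition local_cohomology_nonzero :: "'a list \<Rightarrow> (int \<Rightarrow> 'b set) \<Rightarrow> nat \<Rightarrow> int \<Rightarrow> bool" where
  "local_cohomology_nonzero xs M i n \<longleftrightarrow>
     (\<exists>c \<in> cech_cocycles xs M i n. c \<notin> cech_coboundaries xs M i n)"

text \<open>The supremum of the empty set in \<^typ>\<open>ereal\<close> is \<open>-\<infinity>\<close>, as required.\<close>
definition a_inv :: "'a list \<Rightarrow> (int \<Rightarrow> 'b set) \<Rightarrow> nat \<Rightarrow> ereal" where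
  "a_inv xs M i = (SUP n\<in>{n. local_cohomology_nonzero xs M i n}. ereal (real_of_int n))"

text \<open>
  The cohomology vanishes for \<open>i > length xs\<close>, so the two suprema over all \<open>i\<close> are maxima.
\<close>
definition a_star :: "'a list \<Rightarrow> (int \<Rightarrow> 'b set) \<Rightarrow> ereal" where
  "a_star xs M = (SUP i. a_inv xs M i)"

definition reg :: "'a list \<Rightarrow> (int \<Rightarrow> 'b set) \<Rightarrow> ereal" where
  "reg xs M = (SUP i. a_inv xs M i + ereal (real i))"

end


section \<open>The polynomial ring\<close>

text \<open>
  \<open>('v, 'k) mpoly\<close> with \<open>'v\<close> finite is the polynomial ring over \<open>'k\<close> in (at least one)
  variables indexed by \<open>'v\<close>.  A linear order on \<open>'v\<close> is what the library uses to show that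
  this ring is an integral domain; it also fixes the enumeration \<open>vars\<close>.
\<close>
type_synonym ('v, 'k) mpoly = "('v \<Rightarrow>\<^sub>0 nat) \<Rightarrow>\<^sub>0 'k"

definition Var :: "'v \<Rightarrow> ('v, 'k::field) mpoly" where
  "Var v = Poly_Mapping.single (Poly_Mapping.single v 1) 1"

definition vars :: "('v::{finite,linorder}, 'k::field) mpoly list" where
  "vars = map Var (sorted_list_of_set UNIV)"

definition forms :: "int \<Rightarrow> ('v::finite, 'k::field) mpoly set" where
  "forms n = {g. \<forall>e\<in>Poly_Mapping.keys g. int (\<Sum>v\<in>UNIV. Poly_Mapping.lookup e v) = n}"

text \<open>The span for the module structure of a ring over itself is the generated ideal.\<close>
definition ideal_gen :: "'a::comm_ring_1 set \<Rightarrow> 'a set" where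
  "ideal_gen = module.span (*)"

definition ideal_pow :: "'a::comm_ring_1 set \<Rightarrow> nat \<Rightarrow> 'a set" where
  "ideal_pow I q = ideal_gen {\<Prod>i<q. g i | g. \<forall>i<q. g i \<in> I}"

definition primary_ideal :: "'a::comm_ring_1 set \<Rightarrow> bool" where
  "primary_ideal I \<longleftrightarrow> ideal_gen I = I \<and> I \<noteq> UNIV \<and>
     (\<forall>a b. a * b \<in> I \<longrightarrow> a \<in> I \<or> (\<exists>n. b ^ n \<in> I))"

definition ideal_radical :: "'a::comm_ring_1 set \<Rightarrow> 'a set" where
  "ideal_radical I = {a. \<exists>n. a ^ n \<in> I}"

definition max_ideal :: "('v::finite, 'k::field) mpoly set" where
  "max_ideal = ideal_gen (range Var)"

definition m_primary :: "('v::finite, 'k::field) mpoly set \<Rightarrow> bool" where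
  "m_primary I \<longleftrightarrow> primary_ideal I \<and> ideal_radical I = max_ideal"

definition a_star_pow :: "('v::{finite,linorder}, 'k::field) mpoly set \<Rightarrow> nat \<Rightarrow> ereal" where
  "a_star_pow I q = cech.a_star (*) vars (\<lambda>n. ideal_pow I q \<inter> forms n)"

definition reg_pow :: "('v::{finite,linorder}, 'k::field) mpoly set \<Rightarrow> nat \<Rightarrow> ereal" where
  "reg_pow I q = cech.reg (*) vars (\<lambda>n. ideal_pow I q \<inter> forms n)"


section \<open>The Rees algebra\<close>

text \<open>
  The Rees algebra \<open>A[It]\<close> is a subring of \<open>A[t]\<close>, the type of univariate polynomials over \<open>A\<close>.
\<close>
definition rees :: "nat \<Rightarrow> ('v::finite, 'k::field) mpoly set \<Rightarrow> int \<Rightarrow> int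
    \<Rightarrow> ('v, 'k) mpoly poly set" where
  "rees d I p q = (if q < 0 then {0}
     else {monom a (nat q) | a. a \<in> ideal_pow I (nat q) \<inter> forms (p + int d * q)})"

text \<open>
  The module \<open>rees d I p\<close>, graded by \<open>t\<close>-degree, over \<open>B = k[f\<^sub>0t, \<dots>, f\<^sub>mt]\<close>; the ideal \<open>B\<^sub>+\<close>
  is generated by the \<open>f\<^sub>jt\<close>.
\<close>
definition a_star_rees :: "('v::{finite,linorder}, 'k::field) mpoly list \<Rightarrow> nat
    \<Rightarrow> ('v, 'k) mpoly set \<Rightarrow> int \<Rightarrow> ereal" where
  "a_star_rees fs d I p = cech.a_star (*) (map (\<lambda>f. monom f 1) fs) (rees d I p)"

definition rees_base :: "nat \<Rightarrow> ('v::finite, 'k::field) mpoly set \<Rightarrow> ('v, 'k) mpoly poly set" where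
  "rees_base d I = {h. \<forall>q. monom (coeff h q) q \<in> rees d I 0 (int q)}"

text \<open>The points of \<open>Proj B\<close>: homogeneous primes of \<open>B\<close> not containing \<open>B\<^sub>+\<close>.\<close>
definition Proj_base ::
    "nat \<Rightarrow> ('v::finite, 'k::field) mpoly set \<Rightarrow> ('v, 'k) mpoly poly set set" where
  "Proj_base d I = {P. let B = rees_base d I in
     P \<subseteq> B \<and> P \<noteq> B \<and> 0 \<in> P \<and>
     (\<forall>a\<in>P. \<forall>b\<in>P. a + b \<in> P) \<and> (\<forall>a\<in>B. \<forall>b\<in>P. a * b \<in> P) \<and>
     (\<forall>a\<in>B. \<forall>b\<in>B. a * b \<in> P \<longrightarrow> a \<in> P \<or> b \<in> P) \<and>
     (\<forall>h\<in>P. \<forall>q. monom (coeff h q) q \<in> P) \<and>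
     \<not> {h \<in> B. coeff h 0 = 0} \<subseteq> P}"

text \<open>
  The degree \<open>p\<close> component of the homogeneous localization of the Rees algebra at \<open>P\<close>.  The Rees
  algebra is a domain and \<open>0 \<in> P\<close>, so the localization is formed in the fraction field of \<open>A[t]\<close>.
\<close>
definition fiber_ring :: "nat \<Rightarrow> ('v::{finite,linorder}, 'k::field) mpoly set
    \<Rightarrow> ('v, 'k) mpoly poly set \<Rightarrow> int \<Rightarrow> ('v, 'k) mpoly poly fract set" where
  "fiber_ring d I P p = (if p < 0 then {0}
     else {Fract r s | r s e. r \<in> rees d I p e \<and> s \<in> rees d I 0 e \<and> s \<notin> P})"

text \<open>
  The Rees algebra is generated over \<open>B\<close> by the variables, so their images, of degree \<open>1\<close>, generate
  the irrelevant ideal of \<open>fiber_ring d I P\<close> over its degree \<open>0\<close> part.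
\<close>
definition fiber_vars :: "('v::{finite,linorder}, 'k::field) mpoly poly fract list" where
  "fiber_vars = map (\<lambda>x. Fract [:x:] 1) vars"

definition a_star_phi :: "nat \<Rightarrow> ('v::{finite,linorder}, 'k::field) mpoly set \<Rightarrow> ereal" where
  "a_star_phi d I = (SUP P\<in>Proj_base d I. cech.a_star (*) fiber_vars (fiber_ring d I P))"

definition reg_phi :: "nat \<Rightarrow> ('v::{finite,linorder}, 'k::field) mpoly set \<Rightarrow> ereal" where
  "reg_phi d I = (SUP P\<in>Proj_base d I. cech.reg (*) fiber_vars (fiber_ring d I P))"


section \<open>Stability indexes\<close>

text \<open>Only powers with \<open>q \<ge> 1\<close> are considered; the value is \<open>\<infinity>\<close> if no index works.\<close>
definition stab_a :: "nat \<Rightarrow> ('v::{finite,linorder}, 'k::field) mpoly set \<Rightarrow> enat" where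
  "stab_a d I = Inf {enat qa | qa. 1 \<le> qa \<and>
     (\<forall>q\<ge>qa. a_star_pow I q = ereal (real (d * q)) + a_star_phi d I)}"

definition stab_reg :: "nat \<Rightarrow> ('v::{finite,linorder}, 'k::field) mpoly set \<Rightarrow> enat" where
  "stab_reg d I = Inf {enat qr | qr. 1 \<le> qr \<and>
     (\<forall>q\<ge>qr. reg_pow I q = ereal (real (d * q)) + reg_phi d I)}"

end

theory Submission
  imports Defs "HOL-Computational_Algebra.Polynomial_Factorial"
begin

text \<open>
  Write A for the polynomial ring, n for its number of variables and a for the fibre invariant
  a_star_phi.  Both formulas turn out to be one statement about the quotients A / I^q.

  For q > 0 the quotient A / I^q has finite length, so I^q and A have the same local cohomology
  above degree one, and the first local cohomology of I^q is A / I^q up to that of A.  A monomial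
  Laurent cochain of A can be contracted towards any variable whose exponent is not negative; hence
  H^i(A) in degree k vanishes for i > 0 and k + i > 0.  Consequently a_star(I^q) is the largest
  degree e(q) (called pow_end q) in which I^q does not contain all forms, and reg(I^q) = e(q) + 1:
  a_star_reg_pow.

  On a fibre the situation is even simpler.  The fibre ring R lies in the ring T obtained by
  allowing all forms as numerators in place of the elements of the powers of I.  Some generator f
  of I becomes a unit of T while lying in the ideal of the variables, so the variables generate the
  unit ideal of T and T has no cohomology.  As R and T agree in large
  degrees, H^1 of R is T / R and all other cohomology is zero.  So a_star(R) is the largest degree p
  with T_p \<noteq> R_p and reg(R) is one more: a_star_reg_fiber.  Taking suprema, reg_phi = a + 1, and a is
  an integer because the degrees with T_p \<noteq> R_p are bounded uniformly in the fibre.  It remains to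
  compare e(q) with a + d q.

  Lower bound.  If p + d q is not negative and all forms of this degree lie in I^q for one q > 0,
  then the same holds for all larger q, because a form of degree p + d (q + 1) is a combination of
  the generators with forms of degree p + d q as coefficients.  Multiplying numerators and denominators by a
  power of f then shows T_p = R_p on every fibre (fiber_full_if_pow_full).  For p = a this fails on
  some fibre, so e(q) is at least a + d q for every q > 0.

  Upper bound.  For p > a the forms of the degrees p + d q modulo the powers I^q make up a module
  over B that vanishes at every point of Proj B.  A homogeneous prime that contains an annihilator
  but avoids a generator would contradict this, so every element is killed by powers of the
  generators (torsion_if_fibers_full).  A nonzero element of degree q that is killed in this way
  gives a nonzero class in H^1 of the module R_(p,*), so none exists once q exceeds its a-invariant
  (pow_full_if_fibers_full).  For p = a + 1 this yields that e(q) is at most a + d q.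
\<close>

section \<open>Alternating sums over subsets\<close>

definition alt_sign :: "nat set \<Rightarrow> nat \<Rightarrow> 'a::comm_ring_1" where
  "alt_sign J j = (-1) ^ card {k \<in> J. k < j}"

definition simplicial_diff :: "(nat set \<Rightarrow> 'a::comm_ring_1) \<Rightarrow> nat set \<Rightarrow> 'a" where
  "simplicial_diff c J = (\<Sum>j\<in>J. alt_sign J j * c (J - {j}))"

text \<open>
  The contraction of the cochains of a simplex towards its vertex v.
\<close>
definition cone :: "nat \<Rightarrow> (nat set \<Rightarrow> 'a::comm_ring_1) \<Rightarrow> nat set \<Rightarrow> 'a" where
  "cone v c J = (if v \<in> J then 0 else alt_sign (insert v J) v * c (insert v J))"

lemma alt_sign_square [simp]: "alt_sign J j * alt_sign J j = (1::'a::comm_ring_1)"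
  unfolding alt_sign_def power_add[symmetric] by simp

lemma alt_sign_square_left [simp]: "alt_sign J j * (alt_sign J j * x) = (x::'a::comm_ring_1)"
  unfolding mult.assoc[symmetric] by simp

lemma alt_sign_singleton [simp]: "alt_sign {j} j = 1"
proof -
  have "{k \<in> {j}. k < j} = {}" by auto
  then show ?thesis by (simp only: alt_sign_def card.empty power_0)
qed

text \<open>
  Removing v and j from J with v adjoined, in the two possible orders, gives opposite signs; this
  is what makes the mixed terms of the homotopy formula cancel.
\<close>
lemma alt_sign_swap:
  assumes "finite J" "j \<in> J" "v \<notin> J"
  shows "alt_sign (insert v J) v * alt_sign (insert v J) j
    = - (alt_sign J j * alt_sign (insert v J - {j}) v :: 'a::comm_ring_1)"
proof -
  have vJ: "{k \<in> insert v J. k < v} = {k \<in> J. k < v}" by auto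
  show ?thesis
  proof (cases "v < j")
    case True
    have "{k \<in> insert v J. k < j} = insert v {k \<in> J. k < j}" using True by auto
    moreover have "v \<notin> {k \<in> J. k < j}" using assms by auto
    ultimately have "card {k \<in> insert v J. k < j} = Suc (card {k \<in> J. k < j})"
      using assms(1) by simp
    moreover have "{k \<in> insert v J - {j}. k < v} = {k \<in> J. k < v}" using True by auto
    ultimately show ?thesis unfolding alt_sign_def vJ by simp
  next
    case False
    then have jv: "j < v" using assms by (metis linorder_neqE_nat)
    define K where "K = {k \<in> insert v J - {j}. k < v}"
    have "{k \<in> J. k < v} = insert j K" "j \<notin> K" "finite K" using jv assms by (auto simp: K_def)
    then have "card {k \<in> J. k < v} = Suc (card {k \<in> insert v J - {j}. k < v})"
      unfolding K_def[symmetric] by simp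
    moreover have "{k \<in> insert v J. k < j} = {k \<in> J. k < j}" using jv by auto
    ultimately show ?thesis unfolding alt_sign_def vJ by simp
  qed
qed

text \<open>
  If v is in J, only the summand j = v of the first term survives and gives c J.  Otherwise the
  second term gives c J, and its remaining summands cancel against the first term.
\<close>
lemma cone_homotopy:
  fixes c :: "nat set \<Rightarrow> 'a::comm_ring_1"
  assumes "finite J"
  shows "simplicial_diff (cone v c) J + cone v (simplicial_diff c) J = c J"
proof (cases "v \<in> J")
  case True
  have "simplicial_diff (cone v c) J = (\<Sum>j\<in>J. if j = v then c J else 0)"
    unfolding simplicial_diff_def
  proof (rule sum.cong[OF refl])
    fix j assume "j \<in> J"
    show "alt_sign J j * cone v c (J - {j}) = (if j = v then c J else 0)"
      using True by (auto simp: cone_def insert_absorb)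
  qed
  then show ?thesis using True assms by (simp add: cone_def)
next
  case False
  have *: "alt_sign (insert v J) v * (alt_sign (insert v J) j * c (insert v J - {j}))
      = - (alt_sign J j * cone v c (J - {j}))" if "j \<in> J" for j
  proof -
    have "insert v (J - {j}) = insert v J - {j}" using that False by auto
    then show ?thesis using alt_sign_swap[OF assms that False, where 'a='a] False
      by (simp add: cone_def flip: mult.assoc)
  qed
  have "cone v (simplicial_diff c) J
      = alt_sign (insert v J) v * (\<Sum>j\<in>insert v J. alt_sign (insert v J) j * c (insert v J - {j}))"
    using False by (simp add: cone_def simplicial_diff_def)
  also have "\<dots> = c J + (\<Sum>j\<in>J. alt_sign (insert v J) v * (alt_sign (insert v J) j * c (insert v J - {j})))"
    using False assms by (simp add: distrib_left sum_distrib_left)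
  also have "(\<Sum>j\<in>J. alt_sign (insert v J) v * (alt_sign (insert v J) j * c (insert v J - {j})))
      = - simplicial_diff (cone v c) J"
    using * by (simp add: simplicial_diff_def sum_negf)
  finally show ?thesis by simp
qed

lemma simplicial_diff_divide:
  "simplicial_diff (\<lambda>J. c J / x) J = simplicial_diff c J / (x :: 'a::field)"
  by (simp add: simplicial_diff_def sum_divide_distrib)

section \<open>The Cech complex of graded pieces of a domain\<close>

text \<open>
  Over a domain, all localizations at nonzero elements embed into one field, where fractions can be
  compared and added.  The embedding is a parameter because a fraction field is needed for the
  polynomial ring and the Rees algebra, whereas the fibre rings already lie in a field.
\<close>
locale domain_embedding =
  fixes \<iota> :: "'a::idom \<Rightarrow> 'b::field"
  assumes \<iota>_add: "\<iota> (x + y) = \<iota> x + \<iota> y"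
    and \<iota>_mult: "\<iota> (x * y) = \<iota> x * \<iota> y"
    and \<iota>_one: "\<iota> 1 = 1"
    and \<iota>_inj: "\<iota> x = \<iota> y \<Longrightarrow> x = y"
begin

sublocale cech "(*) :: 'a \<Rightarrow> 'a \<Rightarrow> 'a"
  by unfold_locales (auto simp: algebra_simps)

\<comment> \<open>When scalar multiplication is ring multiplication, this rule reassociates products to the left,
  against the normal form used by the other simplification rules.\<close>
declare scale_scale [simp del]

lemma \<iota>_zero [simp]: "\<iota> 0 = 0"
proof -
  have "\<iota> 0 + \<iota> 0 = \<iota> 0 + 0" using \<iota>_add[of 0 0] by (simp only: add_0_right)
  then show ?thesis by (simp only: add_left_cancel)
qed

lemma \<iota>_eq_0 [simp]: "\<iota> x = 0 \<longleftrightarrow> x = 0"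
  using \<iota>_inj[of x 0] by auto

lemma \<iota>_minus: "\<iota> (- x) = - \<iota> x"
proof -
  have "\<iota> x + \<iota> (- x) = 0"
    using \<iota>_add[of x "- x"] by (simp only: add.right_inverse \<iota>_zero)
  then show ?thesis by (rule minus_unique[symmetric])
qed

lemma \<iota>_power: "\<iota> (x ^ n) = \<iota> x ^ n"
  by (induction n) (auto simp: \<iota>_mult \<iota>_one)

lemma \<iota>_sum: "\<iota> (sum f S) = (\<Sum>s\<in>S. \<iota> (f s))"
  by (induction S rule: infinite_finite_induct) (auto simp: \<iota>_add)

lemma \<iota>_sign: "\<iota> ((-1) ^ k) = (-1) ^ k"
  by (simp only: \<iota>_power \<iota>_minus \<iota>_one)

text \<open>
  The fraction class of pairs with value z in the field; for x = 0 there is one class only.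
\<close>
definition reps :: "'a \<Rightarrow> 'b \<Rightarrow> ('a \<times> nat) set" where
  "reps x z = {(m, s). x = 0 \<or> \<iota> m = z * \<iota> x ^ s}"

lemma frac_eq_reps: "frac x m s = reps x (\<iota> m / \<iota> x ^ s)"
proof (cases "x = 0")
  case True
  then show ?thesis by (auto simp: frac_def reps_def intro!: exI[of _ 1])
next
  case False
  have "(\<exists>k. x ^ (k + s') * m = x ^ (k + s) * m') \<longleftrightarrow> \<iota> m' = \<iota> m / \<iota> x ^ s * \<iota> x ^ s'" for m' s'
  proof -
    have "x ^ (k + s') * m = x ^ (k + s) * m' \<longleftrightarrow> x ^ s' * m = x ^ s * m'" for k
      unfolding power_add mult.assoc using False by simp
    then have "(\<exists>k. x ^ (k + s') * m = x ^ (k + s) * m') \<longleftrightarrow> x ^ s' * m = x ^ s * m'"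
      by blast
    also have "\<dots> \<longleftrightarrow> \<iota> x ^ s' * \<iota> m = \<iota> x ^ s * \<iota> m'"
      unfolding \<iota>_power[symmetric] \<iota>_mult[symmetric] using \<iota>_inj by metis
    also have "\<dots> \<longleftrightarrow> \<iota> m' = \<iota> m / \<iota> x ^ s * \<iota> x ^ s'"
      using False by (simp add: eq_divide_eq mult.commute) argo
    finally show ?thesis .
  qed
  then show ?thesis unfolding frac_def reps_def by (simp only: False simp_thms)
qed

text \<open>
  The values whose class is nonempty.  At x = 0 the class does not depend on the value, so every
  value qualifies.
\<close>
definition is_frac :: "'a \<Rightarrow> 'b \<Rightarrow> bool" where
  "is_frac x z \<longleftrightarrow> x = 0 \<or> (\<exists>m s. z = \<iota> m / \<iota> x ^ s)"

lemma is_frac_mem: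
  assumes "is_frac x z" shows "\<exists>p. p \<in> reps x z"
proof (cases "x = 0")
  case False
  then obtain m s where "z = \<iota> m / \<iota> x ^ s" using assms by (auto simp: is_frac_def)
  then have "(m, s) \<in> reps x z" using False by (simp add: reps_def)
  then show ?thesis by blast
qed (simp add: reps_def)

lemma reps_zero [simp]: "reps 0 z = UNIV"
  by (auto simp: reps_def)

lemma reps_eq_iff:
  assumes "is_frac x z" shows "reps x z = reps x w \<longleftrightarrow> x = 0 \<or> z = w"
proof
  assume eq: "reps x z = reps x w"
  obtain m s where "(m, s) \<in> reps x z" using is_frac_mem[OF assms] by auto
  then have "(m, s) \<in> reps x z" "(m, s) \<in> reps x w" using eq by auto
  then show "x = 0 \<or> z = w" by (auto simp: reps_def)
qed auto

lemma is_frac_0 [simp]: "is_frac x 0"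
  unfolding is_frac_def by (rule disjI2, rule exI[of _ 0]) auto

lemma is_frac_add:
  assumes "is_frac x z" "is_frac x w" shows "is_frac x (z + w)"
proof (cases "x = 0")
  case False
  obtain m s m' s' where zw: "z = \<iota> m / \<iota> x ^ s" "w = \<iota> m' / \<iota> x ^ s'"
    using assms False by (auto simp: is_frac_def)
  have "z + w = \<iota> (m * x ^ s' + m' * x ^ s) / \<iota> x ^ (s + s')"
    using False unfolding zw by (simp add: \<iota>_add \<iota>_mult \<iota>_power power_add add_frac_eq)
  then show ?thesis unfolding is_frac_def by blast
qed (simp add: is_frac_def)

lemma frac_add_reps:
  assumes "is_frac x z" "is_frac x w"
  shows "frac_add x (reps x z) (reps x w) = reps x (z + w)"
proof (cases "x = 0")
  case True
  then show ?thesis by (auto simp: frac_add_def frac_eq_reps)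
next
  case False
  have "frac x (x ^ s' * m + x ^ s * m') (s + s') = reps x (z + w)"
    if "(m, s) \<in> reps x z" "(m', s') \<in> reps x w" for m s m' s'
  proof -
    have "\<iota> m = z * \<iota> x ^ s" "\<iota> m' = w * \<iota> x ^ s'" using that False by (auto simp: reps_def)
    then have "\<iota> (x ^ s' * m + x ^ s * m') / \<iota> x ^ (s + s') = z + w"
      using False by (simp add: \<iota>_add \<iota>_mult \<iota>_power power_add divide_eq_eq ring_distribs)
    then show ?thesis by (simp add: frac_eq_reps)
  qed
  then have "frac_add x (reps x z) (reps x w) = (\<Union>p\<in>reps x z. \<Union>p'\<in>reps x w. reps x (z + w))"
    unfolding frac_add_def by (intro SUP_cong refl) (auto split: prod.splits)
  then show ?thesis using is_frac_mem[OF assms(1)] is_frac_mem[OF assms(2)] by auto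
qed

lemma frac_map_reps:
  assumes "is_frac x z"
  shows "frac_map c x y (reps x z) = reps (x * y) (\<iota> c * z)"
proof (cases "x = 0 \<or> y = 0")
  case True
  then have "x * y = 0" by auto
  then show ?thesis using is_frac_mem[OF assms] by (auto simp: frac_map_def frac_eq_reps)
next
  case False
  have "frac (x * y) ((c * y ^ s) * m) s = reps (x * y) (\<iota> c * z)" if "(m, s) \<in> reps x z" for m s
  proof -
    have "\<iota> m = z * \<iota> x ^ s" using that False by (auto simp: reps_def)
    then have "\<iota> ((c * y ^ s) * m) / \<iota> (x * y) ^ s = \<iota> c * z"
      using False by (simp add: \<iota>_mult \<iota>_power power_mult_distrib)
    then show ?thesis by (simp add: frac_eq_reps)
  qed
  then have "frac_map c x y (reps x z) = (\<Union>p\<in>reps x z. reps (x * y) (\<iota> c * z))"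
    unfolding frac_map_def by (intro SUP_cong refl) (auto split: prod.splits)
  then show ?thesis using is_frac_mem[OF assms] by auto
qed

lemma is_frac_map:
  assumes "is_frac x z" "y \<noteq> 0" shows "is_frac (x * y) (\<iota> c * z)"
proof -
  obtain m s where "z = \<iota> m / \<iota> x ^ s \<or> x = 0" using assms by (auto simp: is_frac_def)
  then have "\<iota> c * z = \<iota> (c * y ^ s * m) / \<iota> (x * y) ^ s \<or> x = 0"
    using assms by (auto simp: \<iota>_mult \<iota>_power power_mult_distrib)
  then show ?thesis unfolding is_frac_def by auto
qed

definition loc :: "(int \<Rightarrow> 'a set) \<Rightarrow> 'a \<Rightarrow> nat \<Rightarrow> int \<Rightarrow> 'b set" where
  "loc M x e n = {\<iota> m / \<iota> x ^ s | m s. m \<in> M (n + int s * int e)}"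

lemma loc_is_frac: "z \<in> loc M x e n \<Longrightarrow> is_frac x z"
  by (auto simp: loc_def is_frac_def)

lemma loc_comp_eq: "loc_comp M x e n = reps x ` loc M x e n"
  by (auto simp: loc_comp_def loc_def frac_eq_reps)

definition cochain_of :: "'a list \<Rightarrow> nat \<Rightarrow> (nat set \<Rightarrow> 'b) \<Rightarrow> nat set \<Rightarrow> ('a \<times> nat) set" where
  "cochain_of xs i c = (\<lambda>J\<in>cech_index xs i. reps (cech_elem xs J) (c J))"

lemma cochain_of_eq_iff:
  "cochain_of xs i c = cochain_of xs i c'
    \<longleftrightarrow> (\<forall>J\<in>cech_index xs i. reps (cech_elem xs J) (c J) = reps (cech_elem xs J) (c' J))"
proof
  assume eq: "cochain_of xs i c = cochain_of xs i c'"
  show "\<forall>J\<in>cech_index xs i. reps (cech_elem xs J) (c J) = reps (cech_elem xs J) (c' J)"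
  proof
    fix J assume "J \<in> cech_index xs i"
    then show "reps (cech_elem xs J) (c J) = reps (cech_elem xs J) (c' J)"
      using fun_cong[OF eq, of J] by (simp add: cochain_of_def)
  qed
qed (auto simp: cochain_of_def intro: restrict_ext)

lemma cech_zero_eq: "cech_zero xs i = cochain_of xs i (\<lambda>_. 0)"
  by (auto simp: cech_zero_def cochain_of_def frac_eq_reps)

lemma cech_indexD: "J \<in> cech_index xs i \<Longrightarrow> finite J \<and> J \<subseteq> {..<length xs} \<and> card J = i"
  unfolding cech_index_def using finite_subset[of J "{..<length xs}"] by simp

lemma cech_index_diff: "J \<in> cech_index xs (Suc i) \<Longrightarrow> j \<in> J \<Longrightarrow> J - {j} \<in> cech_index xs i"
  using finite_subset[of J "{..<length xs}"] by (auto simp: cech_index_def)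

lemma cech_index_insert:
  "J \<in> cech_index xs i \<Longrightarrow> v < length xs \<Longrightarrow> v \<notin> J \<Longrightarrow> insert v J \<in> cech_index xs (Suc i)"
  using finite_subset[of J "{..<length xs}"] by (auto simp: cech_index_def)

lemma cech_cochains_eq:
  "cech_cochains xs M i n
    = cochain_of xs i ` {c. \<forall>J\<in>cech_index xs i. c J \<in> loc M (cech_elem xs J) i n}"
proof (intro equalityI subsetI)
  fix F assume "F \<in> cech_cochains xs M i n"
  then have F: "F \<in> extensional (cech_index xs i)"
    and "\<forall>J\<in>cech_index xs i. \<exists>z\<in>loc M (cech_elem xs J) i n. F J = reps (cech_elem xs J) z"
    by (auto simp: cech_cochains_def PiE_def Pi_def loc_comp_eq image_iff)
  then obtain c where c: "\<forall>J\<in>cech_index xs i. c J \<in> loc M (cech_elem xs J) i n \<and> F J = reps (cech_elem xs J) (c J)"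
    by metis
  then have "F = cochain_of xs i c" using F by (intro ext) (auto simp: cochain_of_def extensional_def restrict_def)
  then show "F \<in> cochain_of xs i ` {c. \<forall>J\<in>cech_index xs i. c J \<in> loc M (cech_elem xs J) i n}"
    using c by blast
qed (auto simp: cech_cochains_def cochain_of_def loc_comp_eq restrict_def PiE_def extensional_def)

lemma cech_elem_diff:
  "J \<in> cech_index xs (Suc i) \<Longrightarrow> j \<in> J \<Longrightarrow> cech_elem xs (J - {j}) * xs ! j = cech_elem xs J"
  using cech_indexD[of J xs "Suc i"]
    prod.remove[of J j "(!) xs"] by (simp add: cech_elem_def mult.commute)

lemma cech_elem_eq_0: "J \<in> cech_index xs i \<Longrightarrow> cech_elem xs J = 0 \<longleftrightarrow> (\<exists>j\<in>J. xs ! j = 0)"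
  using cech_indexD[of J xs i] by (auto simp: cech_elem_def)

text \<open>
  Sums and restrictions of fraction classes are computed on values, so the differential becomes
  the alternating sum.  Where the localized element is zero, both sides are the unique class.
\<close>
lemma cech_diff_eq:
  assumes c: "\<And>J. J \<in> cech_index xs i \<Longrightarrow> is_frac (cech_elem xs J) (c J)"
  shows "cech_diff xs i (cochain_of xs i c) = cochain_of xs (Suc i) (simplicial_diff c)"
proof -
  have "foldr (\<lambda>j. frac_add (cech_elem xs J)
                  (frac_map ((-1) ^ card {k \<in> J. k < j}) (cech_elem xs (J - {j})) (xs ! j)
                    (cochain_of xs i c (J - {j}))))
           (sorted_list_of_set J) (frac (cech_elem xs J) 0 0)
        = reps (cech_elem xs J) (simplicial_diff c J)" (is "?L = _")
    if J: "J \<in> cech_index xs (Suc i)" for J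
  proof (cases "cech_elem xs J = 0")
    case False
    let ?x = "cech_elem xs J"
    have fin: "finite J" using cech_indexD[OF J] by simp
    have "foldr (\<lambda>j. frac_add ?x
                  (frac_map ((-1) ^ card {k \<in> J. k < j}) (cech_elem xs (J - {j})) (xs ! j)
                    (cochain_of xs i c (J - {j})))) js (frac ?x 0 0)
        = reps ?x (\<Sum>j\<leftarrow>js. alt_sign J j * c (J - {j}))
        \<and> is_frac ?x (\<Sum>j\<leftarrow>js. alt_sign J j * c (J - {j}))" if "set js \<subseteq> J" for js
      using that
    proof (induction js)
      case Nil
      then show ?case by (simp add: frac_eq_reps)
    next
      case (Cons j js)
      then have j: "j \<in> J" by simp
      have ind: "J - {j} \<in> cech_index xs i" using cech_index_diff[OF J j] .
      have nz: "xs ! j \<noteq> 0" using False j cech_elem_eq_0[OF J] by auto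
      have eq: "frac_map ((-1) ^ card {k \<in> J. k < j}) (cech_elem xs (J - {j})) (xs ! j)
                    (cochain_of xs i c (J - {j})) = reps ?x (alt_sign J j * c (J - {j}))"
        using ind frac_map_reps[OF c[OF ind], of _ "xs ! j"] cech_elem_diff[OF J j]
        by (simp add: cochain_of_def \<iota>_sign alt_sign_def)
      have fr: "is_frac ?x (alt_sign J j * c (J - {j}))"
        using is_frac_map[OF c[OF ind] nz, of "(-1) ^ card {k \<in> J. k < j}"] cech_elem_diff[OF J j]
        by (simp add: \<iota>_sign alt_sign_def)
      show ?case using Cons frac_add_reps[OF fr] is_frac_add[OF fr] eq by simp
    qed
    from this[of "sorted_list_of_set J"]
    have "?L = reps ?x (\<Sum>j\<leftarrow>sorted_list_of_set J. alt_sign J j * c (J - {j}))"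
      by (simp only: set_sorted_list_of_set[OF fin] subset_refl simp_thms)
    also have "(\<Sum>j\<leftarrow>sorted_list_of_set J. alt_sign J j * c (J - {j})) = simplicial_diff c J"
      unfolding simplicial_diff_def
      by (subst sum_list_distinct_conv_sum_set) (simp_all add: fin)
    finally show ?thesis .
  next
    case True
    have "p \<in> foldr (\<lambda>j. frac_add 0
                  (frac_map ((-1) ^ card {k \<in> J. k < j}) (cech_elem xs (J - {j})) (xs ! j)
                    (cochain_of xs i c (J - {j})))) js (frac 0 0 0)" if "set js \<subseteq> J" for js p
      using that
    proof (induction js arbitrary: p)
      case Nil
      then show ?case by (simp add: frac_eq_reps)
    next
      case (Cons j js)
      then have j: "j \<in> J" by simp
      have ind: "J - {j} \<in> cech_index xs i" using cech_index_diff[OF J j] .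
      have eq: "frac_map ((-1) ^ card {k \<in> J. k < j}) (cech_elem xs (J - {j})) (xs ! j)
                    (cochain_of xs i c (J - {j})) = UNIV"
        using ind frac_map_reps[OF c[OF ind], of _ "xs ! j"] cech_elem_diff[OF J j] True
        by (simp add: cochain_of_def)
      have "set js \<subseteq> J" using Cons.prems by simp
      from Cons.IH[OF this] show ?case
        by (simp add: eq frac_add_def frac_eq_reps) blast
    qed
    then show ?thesis using True cech_indexD[OF J] by auto
  qed
  then show ?thesis
    unfolding cech_diff_def cochain_of_def[of xs "Suc i"] by (rule restrict_ext)
qed

lemma cech_elem_nonzero: "0 \<notin> set xs \<Longrightarrow> J \<in> cech_index xs i \<Longrightarrow> cech_elem xs J \<noteq> 0"
  using cech_elem_eq_0[of J xs i] cech_indexD[of J xs i] by (metis lessThan_iff nth_mem subsetD)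

lemma cech_cocycle_iff:
  assumes "0 \<notin> set xs" "\<forall>J\<in>cech_index xs i. c J \<in> loc M (cech_elem xs J) i n"
  shows "cochain_of xs i c \<in> cech_cocycles xs M i n \<longleftrightarrow>
    (\<forall>J\<in>cech_index xs (Suc i). simplicial_diff c J = 0)"
proof -
  have fr: "is_frac (cech_elem xs J) (c J)" if "J \<in> cech_index xs i" for J
    using assms(2) that loc_is_frac by blast
  have eq: "reps (cech_elem xs J) (simplicial_diff c J) = reps (cech_elem xs J) 0
      \<longleftrightarrow> simplicial_diff c J = 0" if "J \<in> cech_index xs (Suc i)" for J
    using reps_eq_iff[of "cech_elem xs J" 0 "simplicial_diff c J"]
      cech_elem_nonzero[OF assms(1) that] by auto
  have "cech_diff xs i (cochain_of xs i c) = cech_zero xs (Suc i) \<longleftrightarrow>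
     (\<forall>J\<in>cech_index xs (Suc i). reps (cech_elem xs J) (simplicial_diff c J) = reps (cech_elem xs J) 0)"
    by (simp only: cech_diff_eq[of xs i c, OF fr] cech_zero_eq cochain_of_eq_iff)
  then show ?thesis using assms(2) eq by (auto simp: cech_cocycles_def cech_cochains_eq)
qed

text \<open>
  In a domain a global element is determined by its image in one nonzero localization.
\<close>
lemma local_cohomology_0_vanishes:
  assumes "0 \<notin> set xs" "xs \<noteq> []"
  shows "\<not> local_cohomology_nonzero xs M 0 n"
proof
  assume "local_cohomology_nonzero xs M 0 n"
  then obtain F where F: "F \<in> cech_cocycles xs M 0 n" "F \<noteq> cech_zero xs 0"
    by (auto simp: local_cohomology_nonzero_def cech_coboundaries_def)
  then have "F \<in> cech_cochains xs M 0 n" by (simp add: cech_cocycles_def)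
  then obtain c where c: "F = cochain_of xs 0 c" "\<forall>J\<in>cech_index xs 0. c J \<in> loc M (cech_elem xs J) 0 n"
    unfolding cech_cochains_eq by blast
  have idx: "cech_index xs 0 = {{}}"
  proof (intro equalityI subsetI)
    fix J assume "J \<in> cech_index xs 0"
    then show "J \<in> {{}}" using cech_indexD[of J xs 0] card_0_eq[of J] by simp
  qed (simp add: cech_index_def)
  have "{0} \<in> cech_index xs (Suc 0)" using assms(2) by (auto simp: cech_index_def)
  then have "simplicial_diff c {0} = 0" using F(1) cech_cocycle_iff[OF assms(1) c(2)] c(1) by blast
  then have "c {} = 0" by (simp add: simplicial_diff_def)
  then have "F = cech_zero xs 0" unfolding c(1) cech_zero_eq cochain_of_def idx by (intro restrict_ext) auto
  then show False using F(2) by simp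
qed

text \<open>
  Exactness can be checked on families of field elements, without fraction classes.
\<close>
lemma local_cohomology_Suc_vanishes:
  assumes xs: "0 \<notin> set xs"
    and ex: "\<And>c. \<lbrakk>\<forall>J\<in>cech_index xs (Suc i). c J \<in> loc M (cech_elem xs J) (Suc i) n;
        \<forall>J\<in>cech_index xs (Suc (Suc i)). simplicial_diff c J = 0\<rbrakk>
      \<Longrightarrow> \<exists>b. (\<forall>J\<in>cech_index xs i. b J \<in> loc M (cech_elem xs J) i n)
        \<and> (\<forall>J\<in>cech_index xs (Suc i). simplicial_diff b J = c J)"
  shows "\<not> local_cohomology_nonzero xs M (Suc i) n"
proof
  assume "local_cohomology_nonzero xs M (Suc i) n"
  then obtain F where F: "F \<in> cech_cocycles xs M (Suc i) n" "F \<notin> cech_coboundaries xs M (Suc i) n"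
    by (auto simp: local_cohomology_nonzero_def)
  then have "F \<in> cech_cochains xs M (Suc i) n" by (simp add: cech_cocycles_def)
  then obtain c where c: "F = cochain_of xs (Suc i) c"
    "\<forall>J\<in>cech_index xs (Suc i). c J \<in> loc M (cech_elem xs J) (Suc i) n"
    unfolding cech_cochains_eq by blast
  then obtain b where b: "\<forall>J\<in>cech_index xs i. b J \<in> loc M (cech_elem xs J) i n"
    "\<forall>J\<in>cech_index xs (Suc i). simplicial_diff b J = c J"
    using ex[OF c(2)] F(1) cech_cocycle_iff[OF xs c(2)] by blast
  have "F = cochain_of xs (Suc i) (simplicial_diff b)"
    unfolding c(1) cochain_of_def by (intro restrict_ext) (simp add: b(2))
  also have "\<dots> = cech_diff xs i (cochain_of xs i b)"
    using b(1) loc_is_frac by (intro cech_diff_eq[symmetric]) blast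
  finally have "F \<in> cech_coboundaries xs M (Suc i) n"
    unfolding cech_coboundaries_def using b(1) by (auto simp: cech_cochains_eq)
  then show False using F(2) by simp
qed

text \<open>
  A cocycle that is split into cocycles, one for each vertex, is the coboundary of the sum of the
  cones of the pieces over their own vertices.  Contracting the whole cocycle towards one vertex
  would leave the localizations; the splitting is chosen so that the cones stay inside them.
\<close>
lemma simplicial_diff_cone_sum:
  fixes c :: "nat \<Rightarrow> nat set \<Rightarrow> 'c::comm_ring_1"
  assumes cocycle: "\<And>v J. v < length xs \<Longrightarrow> J \<in> cech_index xs (Suc (Suc i)) \<Longrightarrow> simplicial_diff (c v) J = 0"
    and J: "J \<in> cech_index xs (Suc i)"
  shows "simplicial_diff (\<lambda>J. \<Sum>v<length xs. cone v (c v) J) J = (\<Sum>v<length xs. c v J)"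
proof -
  have fin: "finite J" using cech_indexD[OF J] by simp
  have "simplicial_diff (cone v (c v)) J = c v J" if "v < length xs" for v
  proof -
    have "cone v (simplicial_diff (c v)) J = 0"
      using cocycle[OF that] cech_index_insert[OF J that] by (simp add: cone_def)
    then show ?thesis using cone_homotopy[OF fin, of v "c v"] by simp
  qed
  moreover have "simplicial_diff (\<lambda>J. \<Sum>v<length xs. cone v (c v) J) J
      = (\<Sum>v<length xs. simplicial_diff (cone v (c v)) J)"
    unfolding simplicial_diff_def sum_distrib_left by (rule sum.swap)
  ultimately show ?thesis by simp
qed

text \<open>
  The element g lies in the localization of M at each nonzero entry, so it defines a constant cocycle; it is not a
  coboundary because g itself is not in M.
\<close>
lemma local_cohomology_1_nonzero:
  assumes g: "g \<notin> M n" and mem: "\<And>x. x \<in> set xs \<Longrightarrow> x ^ N * g \<in> M (n + int N)"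
    and xs: "\<exists>x\<in>set xs. x \<noteq> 0"
  shows "local_cohomology_nonzero xs M 1 n"
proof -
  \<comment> \<open>The value is g when x is nonzero; in this form the numerator lies in M in any case.\<close>
  define c where "c J = (let x = cech_elem xs J in \<iota> (x ^ N * g) / \<iota> x ^ N)" for J
  define F where "F = cochain_of xs 1 c"
  have c1: "c J = \<iota> g" if "cech_elem xs J \<noteq> 0" for J
    using that by (simp add: c_def Let_def \<iota>_mult \<iota>_power)
  have c_loc: "c J \<in> loc M (cech_elem xs J) 1 n" if J: "J \<in> cech_index xs 1" for J
  proof -
    obtain j where "J = {j}" "j < length xs" using J by (auto simp: cech_index_def card_1_singleton_iff)
    then have "cech_elem xs J ^ N * g \<in> M (n + int N)" using mem by (simp add: cech_elem_def)
    then show ?thesis unfolding loc_def c_def Let_def by force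
  qed
  have fr: "\<And>J. J \<in> cech_index xs 1 \<Longrightarrow> is_frac (cech_elem xs J) (c J)" using c_loc loc_is_frac by blast
  have "F \<in> cech_cocycles xs M 1 n"
  proof -
    have "reps (cech_elem xs J) (simplicial_diff c J) = reps (cech_elem xs J) 0"
      if J: "J \<in> cech_index xs (Suc 1)" for J
    proof (cases "cech_elem xs J = 0")
      case False
      obtain a b where ab: "J = {a, b}" "a < b"
      proof -
        have "card J = 2" using J by (simp add: cech_index_def)
        then obtain x y where "J = {x, y}" "x \<noteq> y" by (auto simp: card_2_iff)
        then show ?thesis using that[of x y] that[of y x] by (cases "x < y") auto
      qed
      have nz: "cech_elem xs (J - {j}) \<noteq> 0" if "j \<in> J" for j
        using cech_elem_diff[OF J that] False by auto
      have d: "J - {a} = {b}" "J - {b} = {a}" "{k \<in> J. k < a} = {}" "{k \<in> J. k < b} = {a}"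
        using ab by auto
      have "simplicial_diff c J = c {b} - c {a}"
        using ab(2) unfolding simplicial_diff_def alt_sign_def
        by (subst (1) ab(1)) (simp add: d)
      then have "simplicial_diff c J = 0" using c1[OF nz[of a]] c1[OF nz[of b]] ab(1) d by simp
      then show ?thesis by simp
    qed simp
    then have "cochain_of xs (Suc 1) (simplicial_diff c) = cech_zero xs (Suc 1)"
      unfolding cech_zero_eq unfolding cochain_of_def by (intro restrict_ext) auto
    then show ?thesis
      unfolding cech_cocycles_def F_def using cech_diff_eq[OF fr] c_loc
      by (auto simp: cech_cochains_eq)
  qed
  moreover have "F \<notin> cech_coboundaries xs M 1 n"
  proof
    assume "F \<in> cech_coboundaries xs M 1 n"
    then obtain b where b: "F = cech_diff xs 0 (cochain_of xs 0 b)"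
      "\<forall>J\<in>cech_index xs 0. b J \<in> loc M (cech_elem xs J) 0 n"
      by (auto simp: cech_coboundaries_def cech_cochains_eq)
    then have F': "F = cochain_of xs (Suc 0) (simplicial_diff b)"
      using cech_diff_eq[of xs 0 b] loc_is_frac by blast
    obtain j where j: "j < length xs" "xs ! j \<noteq> 0" using xs by (auto simp: in_set_conv_nth)
    have J: "{j} \<in> cech_index xs 1" using j by (auto simp: cech_index_def)
    have x: "cech_elem xs {j} = xs ! j" by (simp add: cech_elem_def)
    have "F {j} = reps (xs ! j) (c {j})" unfolding F_def cochain_of_def using J x by simp
    moreover have "F {j} = reps (xs ! j) (simplicial_diff b {j})"
      unfolding F' cochain_of_def using J x by simp
    ultimately have "c {j} = simplicial_diff b {j}" using j(2) reps_eq_iff[OF fr[OF J]] x by auto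
    then have gb: "\<iota> g = b {}" using c1[of "{j}"] x j(2) by (simp add: simplicial_diff_def)
    have "{} \<in> cech_index xs 0" by (simp add: cech_index_def)
    then have "b {} \<in> loc M 1 0 n" using b(2) by (force simp: cech_elem_def)
    then obtain m where "b {} = \<iota> m" "m \<in> M n" by (auto simp: loc_def \<iota>_one)
    then show False using gb g \<iota>_inj by metis
  qed
  ultimately show ?thesis by (auto simp: local_cohomology_nonzero_def)
qed

lemma \<iota>_alt_sign: "\<iota> (alt_sign J j) = alt_sign J j"
  by (simp add: alt_sign_def \<iota>_sign)

lemma \<iota>_simplicial_diff: "simplicial_diff (\<lambda>J. \<iota> (c J)) J = \<iota> (simplicial_diff c J)"
  by (simp add: simplicial_diff_def \<iota>_sum \<iota>_mult \<iota>_alt_sign)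

text \<open>
  There are finitely many index sets, and a fraction may be expanded by the localized element.
\<close>
lemma common_denominator:
  assumes M: "\<And>x n a. x \<in> set xs \<Longrightarrow> a \<in> M n \<Longrightarrow> x * a \<in> M (n + 1)"
    and xs: "0 \<notin> set xs"
    and c: "\<forall>J\<in>cech_index xs i. c J \<in> loc M (cech_elem xs J) i n"
  obtains s m where "\<forall>J\<in>cech_index xs i. m J \<in> M (n + int s * int i) \<and> c J = \<iota> (m J) / \<iota> (cech_elem xs J) ^ s"
proof -
  have "\<exists>m s. m \<in> M (n + int s * int i) \<and> c J = \<iota> m / \<iota> (cech_elem xs J) ^ s" if "J \<in> cech_index xs i" for J
    using c that unfolding loc_def by blast
  then obtain m0 s0 where ms: "m0 J \<in> M (n + int (s0 J) * int i)" "c J = \<iota> (m0 J) / \<iota> (cech_elem xs J) ^ s0 J"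
    if "J \<in> cech_index xs i" for J
    by metis
  have fin: "finite (cech_index xs i)"
    by (rule finite_subset[of _ "Pow {..<length xs}"]) (auto simp: cech_index_def)
  define s where "s = (\<Sum>J\<in>cech_index xs i. s0 J)"
  have le: "s0 J \<le> s" if "J \<in> cech_index xs i" for J
    unfolding s_def using fin that by (simp add: member_le_sum)
  have prod_mem: "(\<Prod>j\<in>K. xs ! j) * a \<in> M (k + int (card K))"
    if "finite K" "K \<subseteq> {..<length xs}" "a \<in> M k" for K a k
    using that
  proof (induction K)
    case (insert j K)
    then have "xs ! j * ((\<Prod>j\<in>K. xs ! j) * a) \<in> M (k + int (card K) + 1)" by (intro M) auto
    then show ?case using insert by (simp add: mult.assoc add.commute add.left_commute)
  qed auto
  have power_mem: "cech_elem xs J ^ t * a \<in> M (k + int t * int i)" if "J \<in> cech_index xs i" "a \<in> M k" for J t a k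
  proof (induction t)
    case (Suc t)
    have "cech_elem xs J * (cech_elem xs J ^ t * a) \<in> M (k + int t * int i + int (card J))"
      unfolding cech_elem_def[of xs J] using cech_indexD[OF that(1)] Suc
      by (intro prod_mem) (auto simp: cech_elem_def)
    then show ?case using cech_indexD[OF that(1)] by (simp add: algebra_simps)
  qed (use that in simp)
  have "cech_elem xs J ^ (s - s0 J) * m0 J \<in> M (n + int s * int i) \<and>
      c J = \<iota> (cech_elem xs J ^ (s - s0 J) * m0 J) / \<iota> (cech_elem xs J) ^ s"
    if J: "J \<in> cech_index xs i" for J
  proof
    have "int (s0 J) * int i + int (s - s0 J) * int i = int s * int i"
      using le[OF J] by (simp add: of_nat_diff algebra_simps)
    then show "cech_elem xs J ^ (s - s0 J) * m0 J \<in> M (n + int s * int i)"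
      using power_mem[OF J ms(1)[OF J], of "s - s0 J"] by (simp add: add.assoc)
    have "\<iota> (cech_elem xs J) ^ s = \<iota> (cech_elem xs J) ^ (s - s0 J) * \<iota> (cech_elem xs J) ^ s0 J"
      using le[OF J] by (simp flip: power_add)
    then show "c J = \<iota> (cech_elem xs J ^ (s - s0 J) * m0 J) / \<iota> (cech_elem xs J) ^ s"
      using ms(2)[OF J] cech_elem_nonzero[OF xs J] by (simp add: \<iota>_mult \<iota>_power)
  qed
  then show ?thesis by (intro that[of "\<lambda>J. cech_elem xs J ^ (s - s0 J) * m0 J" s]) blast
qed

text \<open>
  Index one attains degree e, and nothing lies above this degree or beyond the line n + i = e + 1,
  so both suprema are attained in index one.
\<close>
lemma a_star_reg_eq:
  assumes nz: "local_cohomology_nonzero xs M 1 e"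
    and bd: "\<And>i n. local_cohomology_nonzero xs M i n \<Longrightarrow> n \<le> e \<and> n + int i \<le> e + 1"
  shows "a_star xs M = ereal (real_of_int e)" "reg xs M = ereal (real_of_int e) + 1"
proof -
  have 1: "ereal (real_of_int e) \<le> a_inv xs M 1"
    unfolding a_inv_def using nz by (intro SUP_upper) simp
  have 2: "a_inv xs M i \<le> ereal (real_of_int e)" for i
    unfolding a_inv_def using bd by (intro SUP_least) auto
  have 3: "a_inv xs M i \<le> ereal (real_of_int (e + 1 - int i))" for i
    unfolding a_inv_def
  proof (rule SUP_least)
    fix n assume "n \<in> {n. local_cohomology_nonzero xs M i n}"
    then have "n \<le> e + 1 - int i" using bd[of i n] by simp
    then show "ereal (real_of_int n) \<le> ereal (real_of_int (e + 1 - int i))"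
      by (simp only: ereal_less_eq of_int_le_iff)
  qed
  have 4: "a_inv xs M i + ereal (real i) \<le> ereal (real_of_int e) + 1" for i
  proof -
    have "a_inv xs M i + ereal (real i) \<le> ereal (real_of_int (e + 1 - int i)) + ereal (real i)"
      by (rule add_right_mono[OF 3])
    also have "\<dots> = ereal (real_of_int e) + 1" by (simp add: one_ereal_def)
    finally show ?thesis .
  qed
  show "a_star xs M = ereal (real_of_int e)"
    unfolding a_star_def by (intro antisym SUP_least 2 SUP_upper2[of 1]) (use 1 in auto)
  have "ereal (real_of_int e) + 1 \<le> a_inv xs M 1 + ereal (real 1)"
    using add_right_mono[OF 1, of 1] by (simp add: one_ereal_def)
  then show "reg xs M = ereal (real_of_int e) + 1"
    unfolding reg_def by (intro antisym SUP_least 4 SUP_upper2[of 1]) auto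
qed

end

lemma to_fract_embedding: "domain_embedding to_fract"
  by unfold_locales simp_all

lemma field_embedding: "domain_embedding (\<lambda>a::'a::field. a)"
  by unfold_locales simp_all

section \<open>Forms and monomials\<close>

definition exp_deg :: "('v::finite \<Rightarrow>\<^sub>0 nat) \<Rightarrow> nat" where
  "exp_deg e = (\<Sum>v\<in>UNIV. Poly_Mapping.lookup e v)"

lemma exp_deg_add [simp]: "exp_deg (e + e') = exp_deg e + exp_deg e'"
  by (simp add: exp_deg_def lookup_add sum.distrib)

lemma exp_deg_single [simp]: "exp_deg (Poly_Mapping.single v n) = n"
  by (simp add: exp_deg_def lookup_single when_def)

lemma exp_deg_0 [simp]: "exp_deg 0 = 0"
  by (simp add: exp_deg_def)

lemma forms_iff: "g \<in> forms n \<longleftrightarrow> (\<forall>e\<in>Poly_Mapping.keys g. int (exp_deg e) = n)"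
  by (simp add: forms_def exp_deg_def)

lemma forms_0 [simp]: "0 \<in> forms n"
  by (simp add: forms_iff)

lemma forms_1: "1 \<in> forms 0"
  by (simp add: forms_iff)

lemma forms_add: "f \<in> forms n \<Longrightarrow> g \<in> forms n \<Longrightarrow> f + g \<in> forms n"
  using Poly_Mapping.keys_add[of f g] by (auto simp: forms_iff)

lemma forms_uminus: "g \<in> forms n \<Longrightarrow> - g \<in> forms n"
  by (simp add: forms_iff in_keys_iff)

lemma forms_sum: "(\<And>x. x \<in> X \<Longrightarrow> f x \<in> forms n) \<Longrightarrow> sum f X \<in> forms n"
  by (induction X rule: infinite_finite_induct) (auto intro: forms_add)

lemma forms_mult:
  assumes "f \<in> forms m" "g \<in> forms n" shows "f * g \<in> forms (m + n)"
  unfolding forms_iff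
proof
  fix e assume "e \<in> Poly_Mapping.keys (f * g)"
  then obtain a b where "a \<in> Poly_Mapping.keys f" "b \<in> Poly_Mapping.keys g" "e = a + b"
    using keys_mult[of f g] by blast
  then show "int (exp_deg e) = m + n" using assms by (auto simp: forms_iff)
qed

lemma forms_power: "f \<in> forms m \<Longrightarrow> f ^ n \<in> forms (int n * m)"
proof (induction n)
  case (Suc n)
  then show ?case using forms_mult[of f m "f ^ n" "int n * m"] by (simp add: algebra_simps)
qed (simp add: forms_1)

lemma forms_neg: "g \<in> forms n \<Longrightarrow> n < 0 \<Longrightarrow> g = 0"
  by (metis forms_iff in_keys_iff of_nat_less_0_iff lookup_zero poly_mapping_eqI)

lemma Var_forms: "Var v \<in> forms 1"
  by (simp add: forms_iff Var_def)

lemma Var_nonzero [simp]: "Var v \<noteq> (0 :: ('v, 'k::field) mpoly)"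
  unfolding Var_def by (metis lookup_single_eq lookup_zero zero_neq_one)

lemma Var_power: "Var v ^ n = Poly_Mapping.single (Poly_Mapping.single v n) (1::'k::field)"
  by (induction n) (simp_all add: Var_def mult_single single_add[symmetric])

text \<open>
  Keeping the monomials whose exponents satisfy P.  Homogeneous parts and the splitting used for
  the contraction of Cech cocycles are both of this kind.
\<close>
definition restr :: "('a \<Rightarrow> bool) \<Rightarrow> ('a \<Rightarrow>\<^sub>0 'b::zero) \<Rightarrow> 'a \<Rightarrow>\<^sub>0 'b" where
  "restr P g = Poly_Mapping.mapp (\<lambda>e c. c when P e) g"

lemma lookup_restr: "Poly_Mapping.lookup (restr P g) e = (Poly_Mapping.lookup g e when P e)"
  by (auto simp: restr_def lookup_mapp when_def in_keys_iff)

lemma restr_add: "restr P (f + g) = restr P f + restr P (g :: _ \<Rightarrow>\<^sub>0 'b::monoid_add)"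
  by (rule poly_mapping_eqI) (simp add: lookup_restr lookup_add when_def)

lemma restr_uminus: "restr P (- g) = - restr P (g :: _ \<Rightarrow>\<^sub>0 'b::ab_group_add)"
  by (rule poly_mapping_eqI) (simp add: lookup_restr when_def)

lemma restr_0 [simp]: "restr P 0 = 0"
  by (rule poly_mapping_eqI) (simp add: lookup_restr)

lemma restr_sum: "restr P (sum f X) = (\<Sum>x\<in>X. restr P (f x :: _ \<Rightarrow>\<^sub>0 'b::comm_monoid_add))"
  by (induction X rule: infinite_finite_induct) (auto simp: restr_add)

lemma keys_restr: "Poly_Mapping.keys (restr P g) = {e \<in> Poly_Mapping.keys g. P e}"
  by (auto simp: in_keys_iff lookup_restr)

lemma forms_restr: "g \<in> forms n \<Longrightarrow> restr P g \<in> forms n"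
  by (auto simp: forms_iff keys_restr)

lemma restr_id: "(\<And>e. e \<in> Poly_Mapping.keys g \<Longrightarrow> P e) \<Longrightarrow> restr P g = g"
  by (rule poly_mapping_eqI) (auto simp: lookup_restr when_def in_keys_iff)

lemma restr_none: "(\<And>e. e \<in> Poly_Mapping.keys g \<Longrightarrow> \<not> P e) \<Longrightarrow> restr P g = 0"
  by (rule poly_mapping_eqI) (auto simp: lookup_restr when_def in_keys_iff)

lemma restr_fibers: "(\<Sum>v\<in>(UNIV::'v::finite set). restr (\<lambda>e. h e = v) g) = (g :: _ \<Rightarrow>\<^sub>0 'b::comm_monoid_add)"
  by (rule poly_mapping_eqI) (simp add: lookup_restr lookup_sum when_def)

definition hom_part :: "int \<Rightarrow> ('v::finite, 'k::field) mpoly \<Rightarrow> ('v, 'k) mpoly" where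
  "hom_part n = restr (\<lambda>e. int (exp_deg e) = n)"

lemma hom_part_forms: "hom_part n g \<in> forms n"
  by (auto simp: hom_part_def forms_iff keys_restr)

lemma hom_part_id: "g \<in> forms n \<Longrightarrow> hom_part n g = g"
  unfolding hom_part_def by (rule restr_id) (auto simp: forms_iff)

text \<open>
  A product with a form shifts degrees, so only the part of g of degree n - m contributes.
\<close>
lemma hom_part_mult:
  assumes f: "f \<in> forms m" shows "hom_part n (f * g) = f * hom_part (n - m) g"
proof -
  let ?P = "\<lambda>e. int (exp_deg e) = n - m"
  let ?g1 = "restr ?P g" and ?g2 = "restr (\<lambda>e. \<not> ?P e) g"
  have "f * g = f * (?g1 + ?g2)"
    by (rule arg_cong[of _ _ "(*) f"], rule poly_mapping_eqI) (simp add: lookup_restr lookup_add when_def)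
  then have "hom_part n (f * g) = hom_part n (f * ?g1) + hom_part n (f * ?g2)"
    by (simp only: hom_part_def restr_add distrib_left)
  also have "hom_part n (f * ?g1) = f * ?g1"
    using forms_mult[OF f, of ?g1 "n - m"] by (intro hom_part_id) (auto simp: forms_iff keys_restr)
  also have "hom_part n (f * ?g2) = 0"
    unfolding hom_part_def
  proof (rule restr_none)
    fix e assume "e \<in> Poly_Mapping.keys (f * ?g2)"
    then obtain a b where "a \<in> Poly_Mapping.keys f" "b \<in> Poly_Mapping.keys ?g2" "e = a + b"
      using keys_mult[of f ?g2] by blast
    then show "int (exp_deg e) \<noteq> n" using f by (auto simp: forms_iff keys_restr)
  qed
  finally show ?thesis by (simp add: hom_part_def)
qed

abbreviation mon :: "('v \<Rightarrow>\<^sub>0 nat) \<Rightarrow> ('v, 'k::field) mpoly" where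
  "mon u \<equiv> Poly_Mapping.single u 1"

text \<open>
  Divisibility of monomials; the order that the library puts on exponents is lexicographic.
\<close>
definition exp_le :: "('v \<Rightarrow>\<^sub>0 nat) \<Rightarrow> ('v \<Rightarrow>\<^sub>0 nat) \<Rightarrow> bool" where
  "exp_le u e \<longleftrightarrow> (\<forall>v. Poly_Mapping.lookup u v \<le> Poly_Mapping.lookup e v)"

lemma exp_le_diff: "exp_le u e \<Longrightarrow> u + (e - u) = e"
  by (rule poly_mapping_eqI) (simp add: lookup_add lookup_minus exp_le_def)

lemma poly_mapping_sum_single:
  "(\<Sum>e\<in>Poly_Mapping.keys g. Poly_Mapping.single e (Poly_Mapping.lookup g e)) = (g :: _ \<Rightarrow>\<^sub>0 'b::comm_monoid_add)"
  by (rule poly_mapping_eqI) (auto simp: lookup_sum lookup_single when_def in_keys_iff)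

lemma mon_dvd:
  fixes g :: "('v::finite, 'k::field) mpoly"
  assumes g: "g \<in> forms n" and le: "\<And>e. e \<in> Poly_Mapping.keys g \<Longrightarrow> exp_le u e"
  obtains h where "g = mon u * h" "h \<in> forms (n - int (exp_deg u))"
proof
  let ?h = "\<Sum>e\<in>Poly_Mapping.keys g. Poly_Mapping.single (e - u) (Poly_Mapping.lookup g e)"
  have "mon u * ?h = (\<Sum>e\<in>Poly_Mapping.keys g. Poly_Mapping.single e (Poly_Mapping.lookup g e))"
    unfolding sum_distrib_left by (intro sum.cong refl) (simp add: mult_single exp_le_diff le)
  then show "g = mon u * ?h" by (simp add: poly_mapping_sum_single)
  show "?h \<in> forms (n - int (exp_deg u))"
  proof (rule forms_sum)
    fix e assume e: "e \<in> Poly_Mapping.keys g"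
    have "exp_deg u + exp_deg (e - u) = exp_deg e" using exp_le_diff[OF le[OF e]] by (metis exp_deg_add)
    then show "Poly_Mapping.single (e - u) (Poly_Mapping.lookup g e) \<in> forms (n - int (exp_deg u))"
      using e g by (auto simp: forms_iff)
  qed
qed

lemma keys_mon_mult: "e \<in> Poly_Mapping.keys (mon u * h) \<Longrightarrow> exp_le u e"
  using keys_mult[of "mon u" h] by (auto simp: exp_le_def lookup_add split: if_splits)

text \<open>
  The pigeonhole principle for the exponents of a monomial of large degree.
\<close>
lemma exists_large_exponent:
  fixes e :: "'v::finite \<Rightarrow>\<^sub>0 nat"
  assumes "int (exp_deg e) > int (card (UNIV :: 'v set)) * (int s - 1)"
  shows "\<exists>v. Poly_Mapping.lookup e v \<ge> s"
proof (rule ccontr)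
  assume "\<not> ?thesis"
  then have "int (Poly_Mapping.lookup e v) \<le> int s - 1" for v by (metis linorder_not_le zle_diff1_eq of_nat_less_iff)
  then have "(\<Sum>v\<in>UNIV. int (Poly_Mapping.lookup e v)) \<le> (\<Sum>v\<in>(UNIV::'v set). int s - 1)"
    by (intro sum_mono) auto
  then show False using assms by (simp add: exp_deg_def)
qed

text \<open>
  A variable with exponent at least s, chosen from the exponent alone.  As the choice does not
  depend on the polynomial, the splitting into large parts is additive, hence compatible with the
  Cech differential.
\<close>
definition large_var :: "nat \<Rightarrow> ('v \<Rightarrow>\<^sub>0 nat) \<Rightarrow> 'v" where
  "large_var s e = (SOME v. Poly_Mapping.lookup e v \<ge> s)"

definition large_part :: "nat \<Rightarrow> 'v \<Rightarrow> ('v, 'k::field) mpoly \<Rightarrow> ('v, 'k) mpoly" where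
  "large_part s v = restr (\<lambda>e. large_var s e = v)"

lemma large_part_sum: "(\<Sum>v\<in>UNIV. large_part s v g) = (g :: ('v::finite, 'k::field) mpoly)"
  unfolding large_part_def by (rule restr_fibers)

lemma large_part_keys:
  fixes g :: "('v::finite, 'k::field) mpoly"
  assumes "g \<in> forms n" "n > int (card (UNIV :: 'v set)) * (int s - 1)" "e \<in> Poly_Mapping.keys (large_part s v g)"
  shows "e \<in> Poly_Mapping.keys g" "Poly_Mapping.lookup e v \<ge> s"
proof -
  show e: "e \<in> Poly_Mapping.keys g" using assms(3) by (simp add: large_part_def keys_restr)
  have "\<exists>v. Poly_Mapping.lookup e v \<ge> s"
    using exists_large_exponent[of s e] assms(1,2) e by (simp add: forms_iff)
  then have "Poly_Mapping.lookup e (large_var s e) \<ge> s" unfolding large_var_def by (rule someI_ex)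
  then show "Poly_Mapping.lookup e v \<ge> s" using assms(3) by (simp add: large_part_def keys_restr)
qed

lemma large_part_sign:
  "large_part s v (alt_sign J j * g) = alt_sign J j * large_part s v (g :: ('v, 'k::field) mpoly)"
  by (cases "even (card {k \<in> J. k < j})") (simp_all add: alt_sign_def large_part_def restr_uminus)

lemma large_part_diff:
  fixes C :: "nat set \<Rightarrow> ('v, 'k::field) mpoly"
  shows "large_part s v (simplicial_diff C J) = simplicial_diff (\<lambda>K. large_part s v (C K)) J"
proof -
  have "large_part s v (sum f X) = (\<Sum>x\<in>X. large_part s v (f x))" for f :: "nat \<Rightarrow> ('v, 'k) mpoly" and X
    by (simp add: large_part_def restr_sum)
  then show ?thesis by (simp add: simplicial_diff_def large_part_sign)
qed

text \<open>
  A form of large degree lies in the ideal of the N-th powers of the variables: each of its large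
  parts is divisible by the corresponding power.
\<close>
lemma forms_power_sum:
  fixes g :: "('v::finite, 'k::field) mpoly"
  assumes g: "g \<in> forms n" and n: "n > int (card (UNIV :: 'v set)) * (int N - 1)"
  obtains h where "\<forall>v. h v \<in> forms (n - int N)" "g = (\<Sum>v\<in>UNIV. Var v ^ N * h v)"
proof -
  have "\<exists>h. large_part N v g = Var v ^ N * h \<and> h \<in> forms (n - int N)" for v
  proof -
    have "large_part N v g \<in> forms n" unfolding large_part_def by (rule forms_restr[OF g])
    moreover have "exp_le (Poly_Mapping.single v N) e" if "e \<in> Poly_Mapping.keys (large_part N v g)" for e
      using large_part_keys[OF g n that] by (auto simp: exp_le_def lookup_single when_def)
    ultimately obtain h where "large_part N v g = mon (Poly_Mapping.single v N) * h"
      "h \<in> forms (n - int (exp_deg (Poly_Mapping.single v N)))" by (rule mon_dvd)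
    then show ?thesis by (auto simp: Var_power)
  qed
  then obtain h where "\<And>v. large_part N v g = Var v ^ N * h v \<and> h v \<in> forms (n - int N)" by metis
  then show ?thesis using that[of h] large_part_sum[of N g] by simp
qed

section \<open>Ideals and their powers\<close>

lemma module_ring: "module ((*) :: 'a::comm_ring_1 \<Rightarrow> 'a \<Rightarrow> 'a)"
  by unfold_locales (auto simp: algebra_simps)

lemma ideal_gen_0: "0 \<in> ideal_gen S"
  and ideal_gen_add: "a \<in> ideal_gen S \<Longrightarrow> b \<in> ideal_gen S \<Longrightarrow> a + b \<in> ideal_gen S"
  and ideal_gen_mult: "b \<in> ideal_gen S \<Longrightarrow> a * b \<in> ideal_gen S"
  and ideal_gen_base: "a \<in> S \<Longrightarrow> a \<in> ideal_gen S"
  unfolding ideal_gen_def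
  using module.span_zero[OF module_ring] module.span_add[OF module_ring]
    module.span_scale[OF module_ring] module.span_base[OF module_ring] by blast+

lemma ideal_gen_sum: "(\<And>x. x \<in> X \<Longrightarrow> f x \<in> ideal_gen S) \<Longrightarrow> sum f X \<in> ideal_gen S"
  by (induction X rule: infinite_finite_induct) (auto intro: ideal_gen_0 ideal_gen_add)

lemma ideal_gen_minimal:
  assumes "S \<subseteq> T" "0 \<in> T" "\<And>a b. a \<in> T \<Longrightarrow> b \<in> T \<Longrightarrow> a + b \<in> T" "\<And>a b. b \<in> T \<Longrightarrow> a * b \<in> T"
  shows "ideal_gen S \<subseteq> T"
  unfolding ideal_gen_def
  by (rule module.span_minimal[OF module_ring assms(1)], rule module.subspaceI[OF module_ring])
    (use assms in auto)

lemma ideal_pow_0: "a \<in> ideal_pow I 0"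
proof -
  have "(1::'a) \<in> ideal_pow I 0" unfolding ideal_pow_def by (rule ideal_gen_base) auto
  then show ?thesis using ideal_gen_mult[of 1 _ a] by (simp add: ideal_pow_def)
qed

lemma ideal_pow_zero: "0 \<in> ideal_pow I q"
  and ideal_pow_add: "a \<in> ideal_pow I q \<Longrightarrow> b \<in> ideal_pow I q \<Longrightarrow> a + b \<in> ideal_pow I q"
  and ideal_pow_mult: "b \<in> ideal_pow I q \<Longrightarrow> a * b \<in> ideal_pow I q"
  unfolding ideal_pow_def
  by (fact ideal_gen_0 ideal_gen_add ideal_gen_mult)+

lemma ideal_pow_sum: "(\<And>x. x \<in> X \<Longrightarrow> f x \<in> ideal_pow I q) \<Longrightarrow> sum f X \<in> ideal_pow I q"
  unfolding ideal_pow_def by (rule ideal_gen_sum)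

lemma ideal_pow_Suc_mult:
  assumes a: "a \<in> I" and b: "b \<in> ideal_pow I q"
  shows "a * b \<in> ideal_pow I (Suc q)"
proof -
  have "ideal_pow I q \<subseteq> {b. a * b \<in> ideal_pow I (Suc q)}"
    unfolding ideal_pow_def[of I q]
  proof (rule ideal_gen_minimal)
    show "{\<Prod>i<q. g i |g. \<forall>i<q. g i \<in> I} \<subseteq> {b. a * b \<in> ideal_pow I (Suc q)}"
    proof safe
      fix g assume g: "\<forall>i<q. g i \<in> I"
      have "a * (\<Prod>i<q. g i) = (\<Prod>i<Suc q. (g(q := a)) i)" by (simp add: mult.commute)
      moreover have "\<forall>i<Suc q. (g(q := a)) i \<in> I" using g a by (auto simp: less_Suc_eq)
      ultimately show "a * (\<Prod>i<q. g i) \<in> ideal_pow I (Suc q)"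
        unfolding ideal_pow_def by (intro ideal_gen_base) blast
    qed
  next
    fix x y assume "x \<in> {b. a * b \<in> ideal_pow I (Suc q)}"
    then show "y * x \<in> {b. a * b \<in> ideal_pow I (Suc q)}"
      using ideal_pow_mult[of "a * x" I "Suc q" y] by (simp add: mult.left_commute)
  qed (auto simp: distrib_left ideal_pow_zero intro: ideal_pow_add)
  then show ?thesis using b by blast
qed

text \<open>
  The combinations on the right form an ideal, which contains the products of q + 1 elements of the
  ideal since one factor can be expanded in the generators.
\<close>
lemma ideal_pow_SucE:
  assumes F: "finite F" and g: "g \<in> ideal_pow (ideal_gen F) (Suc q)"
  obtains b where "\<forall>f. b f \<in> ideal_pow (ideal_gen F) q" "g = (\<Sum>f\<in>F. f * b f)"
proof -
  let ?P = "ideal_pow (ideal_gen F) q"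
  let ?T = "{\<Sum>f\<in>F. f * b f | b. \<forall>f. b f \<in> ?P}"
  have T_add: "x + y \<in> ?T" if x: "x \<in> ?T" and y: "y \<in> ?T" for x y
  proof -
    obtain b b' where "\<forall>f. b f \<in> ?P" "\<forall>f. b' f \<in> ?P" "x = (\<Sum>f\<in>F. f * b f)" "y = (\<Sum>f\<in>F. f * b' f)"
      using x y by blast
    then have "x + y = (\<Sum>f\<in>F. f * (b f + b' f)) \<and> (\<forall>f. b f + b' f \<in> ?P)"
      by (auto simp: distrib_left sum.distrib intro: ideal_pow_add)
    then show ?thesis by (intro CollectI) (rule exI[of _ "\<lambda>f. b f + b' f"])
  qed
  have T_mult: "a * x \<in> ?T" if x: "x \<in> ?T" for a x
  proof -
    obtain b where "\<forall>f. b f \<in> ?P" "x = (\<Sum>f\<in>F. f * b f)" using x by blast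
    then have "a * x = (\<Sum>f\<in>F. f * (a * b f)) \<and> (\<forall>f. a * b f \<in> ?P)"
      by (auto simp: sum_distrib_left mult.left_commute intro: ideal_pow_mult)
    then show ?thesis by (intro CollectI) (rule exI[of _ "\<lambda>f. a * b f"])
  qed
  have T_0: "0 \<in> ?T" by (intro CollectI exI[of _ "\<lambda>_. 0"]) (simp add: ideal_pow_zero)
  have gen: "a * p \<in> ?T" if "a \<in> ideal_gen F" "p \<in> ?P" for a p
  proof -
    have "ideal_gen F \<subseteq> {a. a * p \<in> ?T}"
    proof (rule ideal_gen_minimal)
      show "F \<subseteq> {a. a * p \<in> ?T}"
      proof
        fix f0 assume f0: "f0 \<in> F"
        have "f0 * p = (\<Sum>f\<in>F. f * (if f = f0 then p else 0)) \<and> (\<forall>f. (if f = f0 then p else 0) \<in> ?P)"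
          using F f0 that(2) by (simp add: if_distrib[of "(*) _"] ideal_pow_zero cong: if_cong)
        then show "f0 \<in> {a. a * p \<in> ?T}" by (intro CollectI) (rule exI[of _ "\<lambda>f. if f = f0 then p else 0"])
      qed
      show "0 \<in> {a. a * p \<in> ?T}" using T_0 by simp
      show "x + y \<in> {a. a * p \<in> ?T}" if "x \<in> {a. a * p \<in> ?T}" "y \<in> {a. a * p \<in> ?T}" for x y
        using T_add[of "x * p" "y * p"] that by (simp add: distrib_right)
      show "x * y \<in> {a. a * p \<in> ?T}" if "y \<in> {a. a * p \<in> ?T}" for x y
        using T_mult[of "y * p" x] that by (simp add: mult.assoc)
    qed
    then show ?thesis using that(1) by blast
  qed
  have "ideal_pow (ideal_gen F) (Suc q) \<subseteq> ?T"
    unfolding ideal_pow_def[of _ "Suc q"]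
  proof (rule ideal_gen_minimal[OF _ T_0 T_add T_mult])
    show "{\<Prod>i<Suc q. g i |g. \<forall>i<Suc q. g i \<in> ideal_gen F} \<subseteq> ?T"
    proof
      fix x assume "x \<in> {\<Prod>i<Suc q. g i |g. \<forall>i<Suc q. g i \<in> ideal_gen F}"
      then obtain g where x: "x = (\<Prod>i<Suc q. g i)" and g: "\<forall>i<Suc q. g i \<in> ideal_gen F" by blast
      have "(\<Prod>i<q. g i) \<in> ?P" unfolding ideal_pow_def using g by (intro ideal_gen_base) auto
      then have "g q * (\<Prod>i<q. g i) \<in> ?T" using gen g by blast
      then show "x \<in> ?T" unfolding x by (simp only: prod.lessThan_Suc mult.commute)
    qed
  qed
  then show ?thesis using g that by blast
qed

lemma ideal_pow_mult_pow:
  assumes F: "finite F" and "a \<in> ideal_pow (ideal_gen F) q" "b \<in> ideal_pow (ideal_gen F) r"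
  shows "a * b \<in> ideal_pow (ideal_gen F) (q + r)"
  using assms(2)
proof (induction q arbitrary: a)
  case 0
  then show ?case using ideal_pow_mult[OF assms(3)] by simp
next
  case (Suc q)
  obtain c where c: "\<forall>f. c f \<in> ideal_pow (ideal_gen F) q" "a = (\<Sum>f\<in>F. f * c f)"
    by (rule ideal_pow_SucE[OF F Suc.prems])
  have "f * (c f * b) \<in> ideal_pow (ideal_gen F) (Suc (q + r))" if "f \<in> F" for f
    using Suc.IH[OF c(1)[rule_format]] ideal_pow_Suc_mult[OF ideal_gen_base[OF that]] by blast
  then show ?case unfolding c(2) sum_distrib_right mult.assoc by (auto intro: ideal_pow_sum)
qed

lemma ideal_pow_power:
  assumes "a \<in> I" shows "a ^ n \<in> ideal_pow I n"
  by (induction n) (auto intro: ideal_pow_0 ideal_pow_Suc_mult assms)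

lemma ideal_pow_mono_subset:
  assumes "finite F" "a \<in> ideal_pow (ideal_gen F) (Suc q)"
  shows "a \<in> ideal_gen F"
proof -
  obtain b where "a = (\<Sum>f\<in>F. f * b f)" by (rule ideal_pow_SucE[OF assms])
  then have "a = (\<Sum>f\<in>F. b f * f)" by (simp add: mult.commute)
  then show ?thesis by (simp add: ideal_gen_sum ideal_gen_mult ideal_gen_base)
qed

section \<open>Powers of an ideal generated by forms of one degree\<close>

definition var_list :: "'v::{finite,linorder} list" where
  "var_list = sorted_list_of_set UNIV"

lemma vars_nth: "j < card (UNIV :: 'v set) \<Longrightarrow> vars ! j = (Var (var_list ! j) :: ('v::{finite,linorder}, 'k::field) mpoly)"
  by (simp add: vars_def var_list_def)

lemma length_vars: "length (vars :: ('v::{finite,linorder}, 'k::field) mpoly list) = card (UNIV :: 'v set)"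
  by (simp add: vars_def)

lemma set_vars: "set (vars :: ('v::{finite,linorder}, 'k::field) mpoly list) = range Var"
  by (simp add: vars_def)

lemma var_list_bij: "bij_betw ((!) (var_list :: 'v list)) {..<card (UNIV :: 'v set)} (UNIV :: 'v::{finite,linorder} set)"
  unfolding var_list_def by (rule bij_betw_nth) auto

text \<open>
  The exponent of the s-th power of the product of the variables with positions in K.
\<close>
definition box_exp :: "nat \<Rightarrow> nat set \<Rightarrow> 'v::{finite,linorder} \<Rightarrow>\<^sub>0 nat" where
  "box_exp s K = (\<Sum>j\<in>K. Poly_Mapping.single (var_list ! j) s)"

lemma exp_deg_box: "exp_deg (box_exp s K :: 'v::{finite,linorder} \<Rightarrow>\<^sub>0 nat) = s * card K"
  by (induction K rule: infinite_finite_induct) (auto simp: box_exp_def)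

lemma prod_vars_power:
  fixes K :: "nat set"
  assumes "finite K" "K \<subseteq> {..<card (UNIV :: 'v set)}"
  shows "(\<Prod>j\<in>K. vars ! j) ^ s = (mon (box_exp s K) :: ('v::{finite,linorder}, 'k::field) mpoly)"
  using assms
proof (induction K)
  case (insert j K)
  then show ?case
    by (simp add: box_exp_def power_mult_distrib vars_nth Var_power mult_single)
qed (simp add: box_exp_def)

lemma exp_le_box_iff:
  fixes e :: "'v::{finite,linorder} \<Rightarrow>\<^sub>0 nat"
  assumes K: "K \<subseteq> {..<card (UNIV :: 'v set)}"
  shows "exp_le (box_exp s K) e \<longleftrightarrow> (\<forall>j\<in>K. s \<le> Poly_Mapping.lookup e (var_list ! j))"
proof -
  have fin: "finite K" using K finite_subset by blast
  have look: "Poly_Mapping.lookup (box_exp s K) (var_list ! j :: 'v) = (if j \<in> K then s else 0)"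
    if j: "j < card (UNIV :: 'v set)" for j
  proof -
    have inj: "var_list ! i = (var_list ! j :: 'v) \<longleftrightarrow> i = j" if "i \<in> K" for i
      using bij_betw_imp_inj_on[OF var_list_bij[where 'v='v]] j that K
      by (auto dest: inj_onD)
    have "Poly_Mapping.lookup (box_exp s K) (var_list ! j :: 'v) = (\<Sum>i\<in>K. if i = j then s else 0)"
      unfolding box_exp_def lookup_sum lookup_single
      by (intro sum.cong refl) (auto simp: when_def inj)
    then show ?thesis using fin by simp
  qed
  have "exp_le (box_exp s K) e \<longleftrightarrow> (\<forall>j<card (UNIV :: 'v set).
      Poly_Mapping.lookup (box_exp s K) (var_list ! j :: 'v) \<le> Poly_Mapping.lookup e (var_list ! j))"
  proof -
    have all: "(\<forall>w. Q w) \<longleftrightarrow> (\<forall>j<card (UNIV :: 'v set). Q (var_list ! j))" for Q :: "'v \<Rightarrow> bool"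
    proof -
      have "(\<forall>w. Q w) \<longleftrightarrow> (\<forall>w\<in>(!) var_list ` {..<card (UNIV :: 'v set)}. Q w)"
        using bij_betw_imp_surj_on[OF var_list_bij[where 'v='v]] by simp
      then show ?thesis by auto
    qed
    show ?thesis unfolding exp_le_def
      using all[of "\<lambda>w. Poly_Mapping.lookup (box_exp s K) w \<le> Poly_Mapping.lookup e w"] by blast
  qed
  also have "\<dots> \<longleftrightarrow> (\<forall>j\<in>K. s \<le> Poly_Mapping.lookup e (var_list ! j))"
    using K look by auto
  finally show ?thesis .
qed

text \<open>
  Being primary to the maximal homogeneous ideal enters through the powers of the variables.
\<close>
locale equigenerated =
  fixes F I :: "('v::{finite,linorder}, 'k::field) mpoly set" and d :: nat
  assumes F_finite: "finite F" and F_forms: "F \<subseteq> forms (int d)" and d_pos: "d > 0"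
    and I_def: "I = ideal_gen F" and Var_power_mem: "\<exists>N. Var v ^ N \<in> I"
begin

lemma generator_mem: "f \<in> F \<Longrightarrow> f \<in> I"
  unfolding I_def by (rule ideal_gen_base)

text \<open>
  Powers of I are homogeneous, so the coefficients can be replaced by their homogeneous parts.
\<close>
lemma pow_SucE:
  assumes "g \<in> ideal_pow I (Suc q)" "g \<in> forms n"
  obtains b where "\<forall>f. b f \<in> ideal_pow I q \<and> b f \<in> forms (n - int d)" "g = (\<Sum>f\<in>F. f * b f)"
proof -
  have hom: "hom_part k h \<in> ideal_pow I r" if "h \<in> ideal_pow I r" for h k r
    using that
  proof (induction r arbitrary: h k)
    case (Suc r)
    obtain b where b: "\<forall>f. b f \<in> ideal_pow I r" "h = (\<Sum>f\<in>F. f * b f)"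
      using ideal_pow_SucE[OF F_finite Suc.prems[unfolded I_def]] unfolding I_def by blast
    have "hom_part k h = (\<Sum>f\<in>F. f * hom_part (k - int d) (b f))"
      unfolding b(2) hom_part_def[of k] restr_sum
      using hom_part_mult[of _ "int d" k] F_forms unfolding hom_part_def[of k]
      by (intro sum.cong refl) blast
    then show ?case using Suc.IH b(1) generator_mem by (auto intro!: ideal_pow_sum ideal_pow_Suc_mult)
  qed (rule ideal_pow_0)
  obtain b where b: "\<forall>f. b f \<in> ideal_pow I q" "g = (\<Sum>f\<in>F. f * b f)"
    using ideal_pow_SucE[OF F_finite assms(1)[unfolded I_def]] unfolding I_def by blast
  have "g = hom_part n g" using hom_part_id[OF assms(2)] by simp
  also have "\<dots> = (\<Sum>f\<in>F. f * hom_part (n - int d) (b f))"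
    unfolding b(2) hom_part_def[of n] restr_sum
    using hom_part_mult[of _ "int d" n] F_forms unfolding hom_part_def[of n]
    by (intro sum.cong refl) blast
  finally show ?thesis using hom b(1) hom_part_forms by (intro that[of "\<lambda>f. hom_part (n - int d) (b f)"]) auto
qed

text \<open>
  The q-th power is generated in degree d q.
\<close>
lemma pow_eq_0_below:
  assumes "g \<in> ideal_pow I q" "g \<in> forms n" "n < int d * int q"
  shows "g = 0"
  using assms
proof (induction q arbitrary: g n)
  case 0
  then show ?case using forms_neg[of g n] by simp
next
  case (Suc q)
  obtain b where b: "\<forall>f. b f \<in> ideal_pow I q \<and> b f \<in> forms (n - int d)" "g = (\<Sum>f\<in>F. f * b f)"
    using pow_SucE[OF Suc.prems(1,2)] by blast
  have "b f = 0" for f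
    using Suc.IH[of "b f" "n - int d"] b(1) Suc.prems(3) by (simp add: algebra_simps)
  then show ?case using b(2) by simp
qed

lemma pow_1: "a \<in> I \<Longrightarrow> a \<in> ideal_pow I (Suc 0)"
  using ideal_pow_Suc_mult[of a I 1 0] ideal_pow_0[of 1 I] by simp

lemma pow_subset: "q > 0 \<Longrightarrow> a \<in> ideal_pow I q \<Longrightarrow> a \<in> I"
  using ideal_pow_mono_subset[OF F_finite, of a "q - 1"] unfolding I_def by simp

lemma pow_mult: "a \<in> ideal_pow I q \<Longrightarrow> b \<in> ideal_pow I r \<Longrightarrow> a * b \<in> ideal_pow I (q + r)"
  unfolding I_def by (rule ideal_pow_mult_pow[OF F_finite])

text \<open>
  A form of degree n + d in I is a combination of the generators with coefficients of degree n.
\<close>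
lemma pow_full_step:
  assumes "forms n \<subseteq> ideal_pow I q" "forms (n + int d) \<subseteq> I"
  shows "forms (n + int d) \<subseteq> ideal_pow I (Suc q)"
proof
  fix g :: "('v, 'k) mpoly" assume g: "g \<in> forms (n + int d)"
  then obtain b where b: "\<forall>f. b f \<in> ideal_pow I 0 \<and> b f \<in> forms (n + int d - int d)" "g = (\<Sum>f\<in>F. f * b f)"
    using pow_SucE[OF pow_1 g] assms(2) by blast
  then show "g \<in> ideal_pow I (Suc q)"
    using assms(1) generator_mem by (auto intro!: ideal_pow_sum ideal_pow_Suc_mult)
qed

lemma pow_full_mono:
  assumes "forms n \<subseteq> ideal_pow I q" "0 \<le> n" "n \<le> n'"
  shows "forms n' \<subseteq> ideal_pow I q"
  using assms(3)
proof (induction n' rule: int_ge_induct)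
  case (step m)
  show ?case
  proof
    fix g :: "('v, 'k) mpoly" assume g: "g \<in> forms (m + 1)"
    obtain h where h: "\<forall>v. h v \<in> forms (m + 1 - int 1)" "g = (\<Sum>v\<in>UNIV. Var v ^ 1 * h v)"
      by (rule forms_power_sum[OF g, of 1]) (use step assms(2) in auto)
    then show "g \<in> ideal_pow I q" using step.IH by (auto intro!: ideal_pow_sum ideal_pow_mult)
  qed
qed (fact assms(1))

text \<open>
  All forms of a large degree p0 lie in I; each further power of I raises this bound by d only.
  That p0 is independent of q bounds the invariants of all fibres at once.
\<close>
lemma pow_full_uniformly: "\<exists>p0\<ge>0. \<forall>q n. n \<ge> p0 + int d * int q \<longrightarrow> forms n \<subseteq> ideal_pow I q"
proof -
  obtain N where N: "Var v ^ N v \<in> I" for v using Var_power_mem by metis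
  define m where "m = (\<Sum>v\<in>UNIV. N v)"
  have Nm: "Var v ^ m \<in> I" for v
  proof -
    have "N v \<le> m" unfolding m_def by (rule member_le_sum) auto
    then have "Var v ^ m = Var v ^ (m - N v) * (Var v ^ N v :: ('v, 'k) mpoly)" by (simp flip: power_add)
    then show ?thesis using N[of v] ideal_gen_mult unfolding I_def by metis
  qed
  define p0 where "p0 = int (card (UNIV :: 'v set)) * int m"
  have I: "forms n \<subseteq> I" if "n \<ge> p0" for n
  proof
    fix g :: "('v, 'k) mpoly" assume g: "g \<in> forms n"
    have "int (card (UNIV :: 'v set)) * (int m - 1) < n"
      using that card_gt_0_iff[of "UNIV :: 'v set"] by (simp add: p0_def algebra_simps)
    then obtain h where "g = (\<Sum>v\<in>UNIV. Var v ^ m * h v)" using forms_power_sum[OF g, of m] by metis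
    then have "g = (\<Sum>v\<in>UNIV. h v * Var v ^ m)" by (simp add: mult.commute)
    then show "g \<in> I" using Nm unfolding I_def by (auto intro!: ideal_gen_sum ideal_gen_mult)
  qed
  have "forms n \<subseteq> ideal_pow I q" if "n \<ge> p0 + int d * int q" for q n
    using that
  proof (induction q arbitrary: n)
    case 0
    then show ?case using ideal_pow_0 by blast
  next
    case (Suc q)
    have "forms (n - int d) \<subseteq> ideal_pow I q" using Suc by (simp add: algebra_simps)
    moreover have "p0 + 0 \<le> p0 + int d * int (Suc q)" by simp
    then have "forms n \<subseteq> I" using Suc.prems by (intro I) linarith
    ultimately show ?case using pow_full_step[of "n - int d" q] by simp
  qed
  then show ?thesis by (intro exI[of _ p0]) (auto simp: p0_def)
qed

text \<open>
  The end of the quotient by the q-th power, that is, the largest degree in which it is nonzero.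
  Negative degrees are excluded because the zero polynomial is the only form there.
\<close>
definition pow_end :: "nat \<Rightarrow> int" where
  "pow_end q = Max {n. 0 \<le> n \<and> \<not> forms n \<subseteq> ideal_pow I q}"

lemma one_notin_pow: "q > 0 \<Longrightarrow> 1 \<notin> ideal_pow I q"
  using pow_eq_0_below[of 1 q 0] forms_1 d_pos by auto

lemma pow_end:
  assumes "q > 0"
  shows "0 \<le> pow_end q" "\<not> forms (pow_end q) \<subseteq> ideal_pow I q"
    "n > pow_end q \<Longrightarrow> forms n \<subseteq> ideal_pow I q"
proof -
  let ?S = "{n. 0 \<le> n \<and> \<not> forms n \<subseteq> ideal_pow I q}"
  obtain p0 where p0: "n \<ge> p0 + int d * int q \<longrightarrow> forms n \<subseteq> ideal_pow I q" for n
    using pow_full_uniformly by blast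
  have "?S \<subseteq> {0..p0 + int d * int q}"
  proof
    fix n assume n: "n \<in> ?S"
    then have "\<not> p0 + int d * int q \<le> n" using p0[of n] by blast
    then show "n \<in> {0..p0 + int d * int q}" using n by simp
  qed
  then have fin: "finite ?S" using finite_subset by blast
  have "0 \<in> ?S" using one_notin_pow[OF assms] forms_1 by auto
  then have "?S \<noteq> {}" by blast
  then have "pow_end q \<in> ?S" unfolding pow_end_def using Max_in[OF fin] by blast
  then show e: "0 \<le> pow_end q" "\<not> forms (pow_end q) \<subseteq> ideal_pow I q" by auto
  show "forms n \<subseteq> ideal_pow I q" if n: "n > pow_end q"
  proof (rule ccontr)
    assume "\<not> ?thesis"
    then have "n \<in> ?S" using n e(1) by auto
    then have "n \<le> pow_end q" unfolding pow_end_def using Max_ge[OF fin] by blast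
    then show False using n by simp
  qed
qed

end

section \<open>Local cohomology of the powers\<close>

lemma prod_vars_forms:
  assumes "J \<subseteq> {..<length (vars :: ('v::{finite,linorder}, 'k::field) mpoly list)}"
  shows "(\<Prod>j\<in>J. (vars :: ('v::{finite,linorder}, 'k::field) mpoly list) ! j) \<in> forms (int (card J))"
  using finite_subset[OF assms finite_lessThan] assms
proof (induction J)
  case (insert j J)
  then show ?case
    using forms_mult[OF Var_forms, of "\<Prod>j\<in>J. vars ! j" "int (card J)" "var_list ! j"] vars_nth[of j, where 'v='v and 'k='k]
    by (simp add: length_vars)
qed (simp add: forms_1)

lemma zero_notin_vars: "0 \<notin> set (vars :: ('v::{finite,linorder}, 'k::field) mpoly list)"
  by (auto simp: set_vars dest: sym[of 0])

context equigenerated begin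

abbreviation pow_module :: "nat \<Rightarrow> int \<Rightarrow> ('v, 'k) mpoly set" where
  "pow_module q n \<equiv> ideal_pow I q \<inter> forms n"

interpretation domain_embedding "to_fract :: ('v, 'k) mpoly \<Rightarrow> _"
  by (rule to_fract_embedding)

abbreviation \<iota> :: "('v, 'k) mpoly \<Rightarrow> ('v, 'k) mpoly fract" where "\<iota> \<equiv> to_fract"

text \<open>
  Localizing at a variable turns a power of I into the polynomial ring: after expanding the fraction
  its numerator has a degree in which I^q contains all forms.
\<close>
lemma forms_in_localization:
  assumes J: "J \<in> cech_index (vars :: ('v, 'k) mpoly list) i" and i: "i > 0"
    and g: "g \<in> forms (n + int s * int i)"
  shows "\<iota> g / \<iota> (cech_elem vars J) ^ s \<in> loc (pow_module q) (cech_elem vars J) i n"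
proof -
  obtain p0 where p0: "\<forall>q n. n \<ge> p0 + int d * int q \<longrightarrow> forms n \<subseteq> ideal_pow I q"
    using pow_full_uniformly by blast
  let ?x = "cech_elem vars J :: ('v, 'k) mpoly"
  define t where "t = nat (p0 + int d * int q - (n + int s * int i))"
  have x: "?x \<in> forms (int i)"
    using prod_vars_forms[of J, where 'v='v and 'k='k] cech_indexD[OF J] by (simp add: cech_elem_def)
  have "?x ^ t * g \<in> forms (int t * int i + (n + int s * int i))"
    by (rule forms_mult[OF forms_power[OF x] g])
  then have xg: "?x ^ t * g \<in> forms (n + int (s + t) * int i)" by (simp add: algebra_simps)
  have "int t \<le> int t * int i" using i by (simp add: mult_le_cancel_left1)
  then have "p0 + int d * int q \<le> n + int (s + t) * int i"
    unfolding of_nat_add distrib_right t_def by linarith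
  then have "?x ^ t * g \<in> pow_module q (n + int (s + t) * int i)" using p0 xg by blast
  moreover have "\<iota> g / \<iota> ?x ^ s = \<iota> (?x ^ t * g) / \<iota> ?x ^ (s + t)"
    using cech_elem_nonzero[OF zero_notin_vars J] by (simp add: \<iota>_mult \<iota>_power power_add)
  ultimately show ?thesis unfolding loc_def by blast
qed

text \<open>
  With the common denominator X^s, where X is the product of all variables, a cochain becomes a
  family C of polynomials such that C J is divisible by the s-th power of each variable outside J.
  The degree condition says that every monomial of such a polynomial has a variable v with exponent
  at least s.  The corresponding part of C stays divisible by the s-th power of v when v is removed
  from J, so the cone over v of this part stays in the localization at the smaller index set.  For the empty
  index set there is no localization, and the second assumption puts the numerator into I^q.
\<close>
lemma pow_higher_vanishes:
  assumes n: "n + int (Suc i) > 0" and full: "i = 0 \<Longrightarrow> forms n \<subseteq> ideal_pow I q"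
  shows "\<not> local_cohomology_nonzero vars (pow_module q) (Suc i) n"
proof (rule local_cohomology_Suc_vanishes[OF zero_notin_vars])
  let ?V = "card (UNIV :: 'v set)"
  let ?vars = "vars :: ('v, 'k) mpoly list"
  fix c
  assume c: "\<forall>J\<in>cech_index ?vars (Suc i). c J \<in> loc (pow_module q) (cech_elem vars J) (Suc i) n"
    and cocycle: "\<forall>J\<in>cech_index ?vars (Suc (Suc i)). simplicial_diff c J = 0"
  show "\<exists>b. (\<forall>J\<in>cech_index ?vars i. b J \<in> loc (pow_module q) (cech_elem vars J) i n) \<and>
      (\<forall>J\<in>cech_index ?vars (Suc i). simplicial_diff b J = c J)"
  proof (cases "Suc i \<le> ?V")
    case False
    have "J \<notin> cech_index ?vars (Suc i)" for J
    proof
      assume "J \<in> cech_index ?vars (Suc i)"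
      then show False using cech_indexD[of J ?vars "Suc i"] card_mono[of "{..<length ?vars}" J] False
        by (simp add: length_vars)
    qed
    moreover have "0 \<in> loc (pow_module q) (cech_elem vars J) i n" for J
      unfolding loc_def
      by (rule CollectI, rule exI[of _ 0], rule exI[of _ 0]) (simp add: ideal_pow_zero)
    ultimately show ?thesis by (intro exI[of _ "\<lambda>_. 0"]) auto
  next
    case True
    define X where "X = (\<Prod>j<?V. ?vars ! j)"
    \<comment> \<open>The factor that expands a fraction over the variables in J to one over all variables.\<close>
    define co where "co J = (\<Prod>j\<in>{..<?V} - J. ?vars ! j)" for J
    have X_split: "X = cech_elem vars J * co J" if "J \<subseteq> {..<?V}" for J
      unfolding X_def co_def cech_elem_def using that by (simp add: prod.subset_diff mult.commute)
    have X_nz: "X \<noteq> 0"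
      unfolding X_def by (simp add: vars_nth)
    have idx: "J \<subseteq> {..<?V} \<and> finite J \<and> card J = k" if "J \<in> cech_index ?vars k" for J k
      using cech_indexD[OF that] by (simp add: length_vars)
    obtain s m where m: "\<forall>J\<in>cech_index ?vars (Suc i). m J \<in> pow_module q (n + int s * int (Suc i))
        \<and> c J = \<iota> (m J) / \<iota> (cech_elem vars J) ^ s"
    proof (rule common_denominator[OF _ zero_notin_vars c])
      fix x a :: "('v, 'k) mpoly" and k assume "x \<in> set vars" "a \<in> pow_module q k"
      then show "x * a \<in> pow_module q (k + 1)"
        using forms_mult[OF Var_forms, of a k] by (auto simp: set_vars ideal_pow_mult add.commute)
    qed
    define C where "C J = co J ^ s * m J" for J
    have C_forms: "C J \<in> forms (n + int s * int ?V)" if J: "J \<in> cech_index ?vars (Suc i)" for J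
    proof -
      have "card ({..<?V} - J) = ?V - Suc i" using idx[OF J] by (simp add: card_Diff_subset)
      then have "co J \<in> forms (int (?V - Suc i))"
        unfolding co_def using prod_vars_forms[of "{..<?V} - J", where 'v='v and 'k='k]
        by (simp add: length_vars)
      then have "C J \<in> forms (int s * int (?V - Suc i) + (n + int s * int (Suc i)))"
        unfolding C_def using m J by (intro forms_mult forms_power) auto
      then show ?thesis using True by (simp add: of_nat_diff algebra_simps)
    qed
    have C_c: "c J = \<iota> (C J) / \<iota> X ^ s" if J: "J \<in> cech_index ?vars (Suc i)" for J
    proof -
      have "co J \<noteq> 0" using X_split[of J] idx[OF J] X_nz by auto
      then show ?thesis using m J X_split[of J] idx[OF J]
        by (simp add: C_def \<iota>_mult \<iota>_power power_mult_distrib)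
    qed
    define cv where "cv v J = \<iota> (large_part s (var_list ! v) (C J)) / \<iota> X ^ s" for v J
    have cv_cocycle: "simplicial_diff (cv v) J = 0" if J: "J \<in> cech_index ?vars (Suc (Suc i))" for v J
    proof -
      have "\<iota> (simplicial_diff C J) / \<iota> X ^ s = simplicial_diff (\<lambda>J. \<iota> (C J) / \<iota> X ^ s) J"
        by (simp add: simplicial_diff_divide \<iota>_simplicial_diff)
      also have "\<dots> = simplicial_diff c J"
        unfolding simplicial_diff_def using C_c cech_index_diff[OF J] by (intro sum.cong refl) simp
      finally have "simplicial_diff C J = 0" using cocycle J X_nz by simp
      then have "simplicial_diff (\<lambda>K. large_part s (var_list ! v) (C K)) J = 0"
        using large_part_diff[of s "var_list ! v" C J] by (simp add: large_part_def)
      then show ?thesis unfolding cv_def by (simp add: simplicial_diff_divide \<iota>_simplicial_diff)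
    qed
    have cv_sum: "(\<Sum>v<?V. cv v J) = c J" if J: "J \<in> cech_index ?vars (Suc i)" for J
    proof -
      have "(\<Sum>v<?V. large_part s (var_list ! v) (C J)) = (\<Sum>w\<in>UNIV. large_part s w (C J))"
        by (rule sum.reindex_bij_betw[OF var_list_bij])
      then show ?thesis unfolding cv_def C_c[OF J] by (simp add: large_part_sum flip: sum_divide_distrib \<iota>_sum)
    qed
    define b where "b J = (\<Sum>v<?V. cone v (cv v) J)" for J
    have "simplicial_diff b J = c J" if J: "J \<in> cech_index ?vars (Suc i)" for J
      using simplicial_diff_cone_sum[of ?vars i cv J] cv_cocycle J cv_sum[OF J]
      by (simp add: b_def[abs_def] length_vars)
    moreover have "b J \<in> loc (pow_module q) (cech_elem vars J) i n" if J: "J \<in> cech_index ?vars i" for J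
    proof -
      let ?x = "cech_elem ?vars J"
      have "\<exists>h. h \<in> forms (n + int s * int i) \<and> cone v (cv v) J = \<iota> h / \<iota> ?x ^ s" if v: "v < ?V" for v
      proof (cases "v \<in> J")
        case True
        then show ?thesis by (intro exI[of _ 0]) (simp add: cone_def)
      next
        case False
        let ?J = "insert v J"
        have J': "?J \<in> cech_index ?vars (Suc i)" using cech_index_insert[OF J _ False] v by (simp add: length_vars)
        let ?g = "large_part s (var_list ! v) (C ?J)"
        have "?g \<in> forms (n + int s * int ?V)" unfolding large_part_def by (rule forms_restr[OF C_forms[OF J']])
        moreover have "exp_le (box_exp s ({..<?V} - J)) e" if e: "e \<in> Poly_Mapping.keys ?g" for e
        proof -
          have "int ?V * (int s - 1) < n + int s * int ?V"
            using n \<open>Suc i \<le> ?V\<close> by (simp add: algebra_simps)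
          note large = large_part_keys[OF C_forms[OF J'] this e]
          have "co ?J ^ s = mon (box_exp s ({..<?V} - ?J))"
            unfolding co_def by (rule prod_vars_power) auto
          then have "exp_le (box_exp s ({..<?V} - ?J)) e"
            using large(1) keys_mon_mult unfolding C_def by metis
          then have "\<forall>j\<in>{..<?V} - ?J. s \<le> Poly_Mapping.lookup e (var_list ! j)"
            by (subst (asm) exp_le_box_iff) auto
          then show ?thesis using large(2) by (subst exp_le_box_iff) auto
        qed
        ultimately obtain h where h: "?g = mon (box_exp s ({..<?V} - J)) * h"
          "h \<in> forms (n + int s * int ?V - int (exp_deg (box_exp s ({..<?V} - J) :: 'v \<Rightarrow>\<^sub>0 nat)))"
          by (rule mon_dvd)
        have "co J ^ s = mon (box_exp s ({..<?V} - J))"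
          unfolding co_def by (rule prod_vars_power) auto
        then have g: "?g = co J ^ s * h" using h(1) by simp
        have "card ({..<?V} - J) = ?V - i" using idx[OF J] by (simp add: card_Diff_subset)
        then have hf: "h \<in> forms (n + int s * int i)"
          using h(2) \<open>Suc i \<le> ?V\<close> by (simp add: exp_deg_box of_nat_diff algebra_simps)
        have "co J \<noteq> 0" using X_split[of J] idx[OF J] X_nz by auto
        then have "cv v ?J = \<iota> h / \<iota> ?x ^ s"
          unfolding cv_def g using X_split[of J] idx[OF J] by (simp add: \<iota>_mult \<iota>_power power_mult_distrib)
        then have "cone v (cv v) J = \<iota> (alt_sign ?J v * h) / \<iota> ?x ^ s"
          using False by (simp add: cone_def \<iota>_mult \<iota>_alt_sign)
        moreover have "alt_sign ?J v * h \<in> forms (n + int s * int i)"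
          using hf forms_uminus[OF hf] by (cases "even (card {k \<in> ?J. k < v})") (simp_all add: alt_sign_def)
        ultimately show ?thesis by blast
      qed
      then obtain h where h: "\<forall>v<?V. h v \<in> forms (n + int s * int i) \<and> cone v (cv v) J = \<iota> (h v) / \<iota> ?x ^ s"
        by metis
      have b: "b J = \<iota> (\<Sum>v<?V. h v) / \<iota> ?x ^ s"
        unfolding b_def \<iota>_sum sum_divide_distrib using h by (intro sum.cong refl) auto
      have hs: "(\<Sum>v<?V. h v) \<in> forms (n + int s * int i)" using h by (intro forms_sum) auto
      show ?thesis
      proof (cases "i = 0")
        case False
        then show ?thesis unfolding b using forms_in_localization[OF J _ hs] by simp
      next
        case True
        then have "(\<Sum>v<?V. h v) \<in> pow_module q (n + int s * int i)" using hs full by auto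
        then show ?thesis unfolding b loc_def by blast
      qed
    qed
    ultimately show ?thesis by blast
  qed
qed

text \<open>
  A form outside I^q of the last possible degree is moved into I^q by every variable, so it is a
  nonzero class of H^1.  Everything beyond it vanishes because the end is not negative.
\<close>
lemma a_star_reg_pow:
  assumes q: "q > 0"
  shows "a_star_pow I q = ereal (real_of_int (pow_end q))"
    "reg_pow I q = ereal (real_of_int (pow_end q)) + 1"
proof -
  have ne: "(vars :: ('v, 'k) mpoly list) \<noteq> []" using length_vars[where 'v='v and 'k='k] by auto
  obtain g :: "('v, 'k) mpoly" where g: "g \<in> forms (pow_end q)" "g \<notin> ideal_pow I q" using pow_end(2)[OF q] by blast
  have nz: "local_cohomology_nonzero vars (pow_module q) 1 (pow_end q)"
  proof (rule local_cohomology_1_nonzero[of g _ _ _ 1])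
    fix x :: "('v, 'k) mpoly" assume "x \<in> set vars"
    then have "x * g \<in> forms (pow_end q + 1)"
      using forms_mult[OF Var_forms g(1)] by (auto simp: set_vars add.commute)
    then show "x ^ 1 * g \<in> pow_module q (pow_end q + int 1)" using pow_end(3)[OF q, of "pow_end q + 1"] by auto
  qed (use g zero_notin_vars ne in \<open>auto simp: set_vars\<close>)
  have "n \<le> pow_end q \<and> n + int i \<le> pow_end q + 1" if nzi: "local_cohomology_nonzero vars (pow_module q) i n" for i n
  proof -
    obtain k where i: "i = Suc k" using local_cohomology_0_vanishes[OF zero_notin_vars ne] nzi by (cases i) auto
    show ?thesis
    proof (rule ccontr)
      assume no: "\<not> ?thesis"
      have "n + int (Suc k) > 0" using no pow_end(1)[OF q] by (auto simp: i)
      moreover have "k = 0 \<Longrightarrow> forms n \<subseteq> ideal_pow I q" using no i by (intro pow_end(3)[OF q]) auto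
      ultimately show False using pow_higher_vanishes nzi i by blast
    qed
  qed
  from a_star_reg_eq[OF nz this] show "a_star_pow I q = ereal (real_of_int (pow_end q))"
    "reg_pow I q = ereal (real_of_int (pow_end q)) + 1"
    unfolding a_star_pow_def reg_pow_def by auto
qed

end

section \<open>The fibre rings\<close>

definition tmon :: "'a::idom \<Rightarrow> nat \<Rightarrow> 'a poly fract" where
  "tmon a e = to_fract (monom a e)"

lemma tmon_mult: "tmon a e * tmon b e' = tmon (a * b) (e + e')"
  by (simp add: tmon_def mult_monom flip: to_fract_mult)

lemma tmon_add: "tmon a e + tmon b e = tmon (a + b) e"
  by (simp add: tmon_def add_monom flip: to_fract_add)

lemma tmon_uminus: "- tmon a e = tmon (- a) e"
  by (simp add: tmon_def minus_monom flip: to_fract_uminus)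

lemma tmon_sum: "(\<Sum>x\<in>X. tmon (f x) e) = tmon (sum f X) e"
  by (induction X rule: infinite_finite_induct) (simp_all add: tmon_add, simp_all add: tmon_def)

lemma tmon_eq_0 [simp]: "tmon a e = 0 \<longleftrightarrow> a = 0"
  by (simp add: tmon_def)

lemma tmon_one: "tmon 1 0 = 1"
  by (simp add: tmon_def monom_0 flip: one_pCons)

lemma tmon_power: "tmon a e ^ n = tmon (a ^ n) (n * e)"
  by (induction n) (simp_all add: tmon_one tmon_mult)

lemma tmon_eq_iff [simp]: "tmon a e = tmon b e \<longleftrightarrow> a = b"
  by (simp add: tmon_def)

lemma Fract_monom: "Fract (monom a e) (monom b e') = tmon a e / tmon b e'"
  by (simp add: tmon_def Fract_conv_to_fract)

locale fiber = equigenerated F I d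
  for F I :: "('v::{finite,linorder}, 'k::field) mpoly set" and d :: nat +
  fixes P assumes P: "P \<in> Proj_base d I"
begin

lemma prime_props:
  shows "P \<subseteq> rees_base d I" "P \<noteq> rees_base d I" "0 \<in> P"
    "a \<in> P \<Longrightarrow> b \<in> P \<Longrightarrow> a + b \<in> P"
    "a \<in> rees_base d I \<Longrightarrow> b \<in> P \<Longrightarrow> a * b \<in> P"
    "a \<in> rees_base d I \<Longrightarrow> b \<in> rees_base d I \<Longrightarrow> a * b \<in> P \<Longrightarrow> a \<in> P \<or> b \<in> P"
    "\<not> {h \<in> rees_base d I. coeff h 0 = 0} \<subseteq> P"
  using P unfolding Proj_base_def Let_def by blast+

end

context equigenerated begin

lemma rees_nat: "rees d I p (int q) = {monom a q |a. a \<in> ideal_pow I q \<inter> forms (p + int d * int q)}"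
  by (simp add: rees_def)

lemma monom_in_base:
  assumes "b \<in> pow_module e (int d * int e)" shows "monom b e \<in> rees_base d I"
  unfolding rees_base_def rees_nat
proof safe
  fix q
  have "coeff (monom b e) q \<in> pow_module q (0 + int d * int q)"
    using assms by (auto simp: ideal_pow_zero)
  then show "\<exists>a. monom (coeff (monom b e) q) q = monom a q \<and> a \<in> pow_module q (0 + int d * int q)" by blast
qed

lemma base_coeff: "h \<in> rees_base d I \<Longrightarrow> coeff h q \<in> pow_module q (int d * int q)"
  unfolding rees_base_def rees_nat by auto

end

context fiber begin

text \<open>
  The elements b such that b t^e is an admissible denominator in the homogeneous localization.
\<close>
definition denom :: "nat \<Rightarrow> ('v, 'k) mpoly set" where
  "denom e = {b \<in> pow_module e (int d * int e). monom b e \<notin> P}"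

lemma denom_nonzero: "b \<in> denom e \<Longrightarrow> b \<noteq> 0"
  using prime_props(3) by (auto simp: denom_def)

lemma denom_mult:
  assumes "b \<in> denom e" "b' \<in> denom e'" shows "b * b' \<in> denom (e + e')"
proof -
  have "monom b e * monom b' e' \<notin> P"
    using assms prime_props(6)[OF monom_in_base monom_in_base] by (auto simp: denom_def)
  then show ?thesis using assms pow_mult forms_mult[of b "int d * int e" b' "int d * int e'"]
    by (auto simp: denom_def mult_monom algebra_simps)
qed

lemma denom_one: "1 \<in> denom 0"
proof -
  have "1 \<notin> P"
  proof
    assume "1 \<in> P"
    then have "rees_base d I \<subseteq> P" using prime_props(5)[of _ 1] by auto
    then show False using prime_props(1,2) by blast
  qed
  then show ?thesis by (simp add: denom_def ideal_pow_0 forms_1 monom_0 flip: one_pCons)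
qed

lemma denom_power: "b \<in> denom e \<Longrightarrow> b ^ n \<in> denom (n * e)"
  by (induction n) (auto simp: denom_one denom_mult)

lemma P_sum: "(\<And>x. x \<in> X \<Longrightarrow> f x \<in> P) \<Longrightarrow> sum f X \<in> P"
  by (induction X rule: infinite_finite_induct) (auto intro: prime_props(3,4))

text \<open>
  The elements of positive t-degree in B are generated by the f t, so P cannot contain all of them.
\<close>
lemma denom_generator: obtains f where "f \<in> F" "f \<in> denom 1"
proof -
  have "\<exists>f\<in>F. monom f 1 \<notin> P"
  proof (rule ccontr)
    assume "\<not> ?thesis"
    then have gen: "monom f 1 \<in> P" if "f \<in> F" for f using that by blast
    have "h \<in> P" if h: "h \<in> rees_base d I" "coeff h 0 = 0" for h
    proof -
      have "monom (coeff h q) q \<in> P" for q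
      proof (cases q)
        case 0
        then show ?thesis using h(2) prime_props(3) by simp
      next
        case (Suc r)
        have c: "coeff h q \<in> ideal_pow I (Suc r)" "coeff h q \<in> forms (int d * int (Suc r))"
          using base_coeff[OF h(1), of q] Suc by auto
        obtain b where b: "\<forall>f. b f \<in> ideal_pow I r \<and> b f \<in> forms (int d * int (Suc r) - int d)"
          "coeff h q = (\<Sum>f\<in>F. f * b f)"
          using pow_SucE[OF c] by blast
        have "int d * int (Suc r) - int d = int d * int r" by (simp add: algebra_simps)
        then have "monom (b f) r \<in> rees_base d I" for f using b(1) by (intro monom_in_base) auto
        then have "monom (b f) r * monom f 1 \<in> P" if "f \<in> F" for f
          using gen[OF that] by (rule prime_props(5))
        then have "(\<Sum>f\<in>F. monom (b f) r * monom f 1) \<in> P" by (rule P_sum)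
        moreover have "monom (coeff h q) q = (\<Sum>f\<in>F. monom (b f) r * monom f 1)"
          unfolding b(2) by (simp add: Suc monom_sum mult_monom mult.commute)
        ultimately show ?thesis by simp
      qed
      then have "(\<Sum>q\<le>degree h. monom (coeff h q) q) \<in> P" by (intro P_sum) auto
      then show ?thesis by (simp add: poly_as_sum_of_monoms)
    qed
    then show False using prime_props(7) by blast
  qed
  then obtain f where f: "f \<in> F" "monom f 1 \<notin> P" by blast
  then have "f \<in> denom 1" using F_forms pow_1 generator_mem by (auto simp: denom_def)
  then show ?thesis using f(1) that by blast
qed

text \<open>
  The ring T of fractions with arbitrary forms as numerators.  It is nonzero in negative degrees too:
  the generator outside P is a unit of degree d.
\<close>
definition fiber_full :: "int \<Rightarrow> ('v, 'k) mpoly poly fract set" where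
  "fiber_full p = {tmon a e / tmon b e | a b e. a \<in> forms (p + int d * int e) \<and> b \<in> denom e}"

abbreviation fiber_part :: "int \<Rightarrow> ('v, 'k) mpoly poly fract set" where
  "fiber_part \<equiv> fiber_ring d I P"

text \<open>
  In negative degrees p the numerators vanish, since I^e is zero in degrees below d e.
\<close>
lemma fiber_ring_eq:
  "fiber_part p = {tmon a e / tmon b e | a b e. a \<in> pow_module e (p + int d * int e) \<and> b \<in> denom e}"
    (is "_ = ?R")
proof (cases "p < 0")
  case True
  have sub: "?R \<subseteq> {0}"
  proof
    fix z assume "z \<in> ?R"
    then obtain a b e where z: "z = tmon a e / tmon b e" "a \<in> pow_module e (p + int d * int e)" by blast
    then have "a = 0" using pow_eq_0_below[of a e "p + int d * int e"] True by simp
    then show "z \<in> {0}" using z by (simp add: tmon_def)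
  qed
  have mem: "0 \<in> ?R"
    using denom_one by (intro CollectI exI[of _ 0] exI[of _ 1]) (simp add: ideal_pow_zero tmon_def)
  have part: "fiber_part p = {0}" using True by (simp add: fiber_ring_def)
  show ?thesis unfolding part
  proof (rule equalityI)
    show "{0} \<subseteq> ?R" unfolding subset_iff singleton_iff using mem by (simp only: simp_thms)
  qed (fact sub)
next
  case False
  have "fiber_part p \<subseteq> ?R"
  proof
    fix z assume "z \<in> fiber_part p"
    then obtain r s e where z: "z = Fract r s" "r \<in> rees d I p e" "s \<in> rees d I 0 e" "s \<notin> P"
      using False by (auto simp: fiber_ring_def)
    have "e \<ge> 0" using z(3,4) prime_props(3) by (auto simp: rees_def split: if_splits)
    then obtain k where k: "e = int k" using nonneg_int_cases by blast
    then obtain a b where "r = monom a k" "a \<in> pow_module k (p + int d * int k)"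
      "s = monom b k" "b \<in> pow_module k (0 + int d * int k)"
      using z(2,3) unfolding k rees_nat by blast
    then show "z \<in> ?R" using z by (auto simp: Fract_monom denom_def)
  qed
  moreover have "?R \<subseteq> fiber_part p"
  proof
    fix z assume "z \<in> ?R"
    then obtain a b e where z: "z = tmon a e / tmon b e" "a \<in> pow_module e (p + int d * int e)" "b \<in> denom e" by blast
    have "monom a e \<in> rees d I p (int e)" "monom b e \<in> rees d I 0 (int e)" "monom b e \<notin> P"
      using z unfolding rees_nat by (auto simp: denom_def)
    then have "Fract (monom a e) (monom b e) \<in> fiber_part p" using False by (auto simp: fiber_ring_def)
    then show "z \<in> fiber_part p" using z(1) by (simp add: Fract_monom)
  qed
  ultimately show ?thesis by (rule equalityI)
qed

lemma fiber_part_subset: "fiber_part p \<subseteq> fiber_full p"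
  unfolding fiber_ring_eq fiber_full_def by blast

lemma fiber_full_0 [simp]: "0 \<in> fiber_full p"
  unfolding fiber_full_def using denom_one
  by (intro CollectI exI[of _ 0] exI[of _ 1]) (simp add: tmon_def)

lemma fiber_full_add:
  assumes "y \<in> fiber_full p" "z \<in> fiber_full p" shows "y + z \<in> fiber_full p"
proof -
  obtain a b e a' b' e' where y: "y = tmon a e / tmon b e" "a \<in> forms (p + int d * int e)" "b \<in> denom e"
    and z: "z = tmon a' e' / tmon b' e'" "a' \<in> forms (p + int d * int e')" "b' \<in> denom e'"
    using assms unfolding fiber_full_def by blast
  have bf: "b \<in> forms (int d * int e)" "b' \<in> forms (int d * int e')" using y z by (auto simp: denom_def)
  have "a * b' \<in> forms (p + int d * int (e + e'))" "a' * b \<in> forms (p + int d * int (e + e'))"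
    using forms_mult[OF y(2) bf(2)] forms_mult[OF z(2) bf(1)] by (simp_all add: algebra_simps)
  then have "a * b' + a' * b \<in> forms (p + int d * int (e + e'))" by (rule forms_add)
  moreover have "y + z = tmon (a * b' + a' * b) (e + e') / tmon (b * b') (e + e')"
    using denom_nonzero[OF y(3)] denom_nonzero[OF z(3)] unfolding y(1) z(1)
    by (subst add_frac_eq) (simp_all add: tmon_mult tmon_add add.commute)
  ultimately show ?thesis using denom_mult[OF y(3) z(3)] unfolding fiber_full_def by blast
qed

lemma fiber_full_mult:
  assumes "y \<in> fiber_full p" "z \<in> fiber_full p'" shows "y * z \<in> fiber_full (p + p')"
proof -
  obtain a b e a' b' e' where y: "y = tmon a e / tmon b e" "a \<in> forms (p + int d * int e)" "b \<in> denom e"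
    and z: "z = tmon a' e' / tmon b' e'" "a' \<in> forms (p' + int d * int e')" "b' \<in> denom e'"
    using assms unfolding fiber_full_def by blast
  have "a * a' \<in> forms (p + p' + int d * int (e + e'))"
    using forms_mult[OF y(2) z(2)] by (simp add: algebra_simps)
  moreover have "y * z = tmon (a * a') (e + e') / tmon (b * b') (e + e')"
    unfolding y(1) z(1) by (simp add: tmon_mult)
  ultimately show ?thesis using denom_mult[OF y(3) z(3)] unfolding fiber_full_def by blast
qed

lemma fiber_full_sum: "(\<And>x. x \<in> X \<Longrightarrow> f x \<in> fiber_full p) \<Longrightarrow> sum f X \<in> fiber_full p"
  by (induction X rule: infinite_finite_induct) (auto intro: fiber_full_add)

lemma forms_fiber_full: "a \<in> forms p \<Longrightarrow> tmon a 0 \<in> fiber_full p"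
  unfolding fiber_full_def using denom_one
  by (intro CollectI exI[of _ a] exI[of _ 1] exI[of _ 0]) (simp add: tmon_one)

lemma fiber_full_power: "z \<in> fiber_full p \<Longrightarrow> z ^ n \<in> fiber_full (int n * p)"
proof (induction n)
  case 0
  then show ?case using forms_fiber_full[OF forms_1] by (simp add: tmon_one)
next
  case (Suc n)
  then show ?case using fiber_full_mult[of z p "z ^ n" "int n * p"] by (simp add: algebra_simps)
qed

lemma fiber_full_uminus: "z \<in> fiber_full p \<Longrightarrow> - z \<in> fiber_full p"
  using fiber_full_mult[OF forms_fiber_full[OF forms_uminus[OF forms_1]], of z p]
  by (simp add: tmon_one flip: tmon_uminus)

text \<open>
  The same bound works for all denominators, hence for all fibres.
\<close>
lemma fiber_full_eventually:
  assumes "\<forall>q n. n \<ge> p0 + int d * int q \<longrightarrow> forms n \<subseteq> ideal_pow I q" "p \<ge> p0"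
  shows "fiber_full p \<subseteq> fiber_part p"
proof
  fix z assume "z \<in> fiber_full p"
  then obtain a b e where z: "z = tmon a e / tmon b e" "a \<in> forms (p + int d * int e)" "b \<in> denom e"
    unfolding fiber_full_def by blast
  have "forms (p + int d * int e) \<subseteq> ideal_pow I e" using assms by simp
  then have "a \<in> pow_module e (p + int d * int e)" using z(2) by blast
  then show "z \<in> fiber_part p" using z unfolding fiber_ring_eq by blast
qed

lemma fiber_full_large: "\<exists>p0. \<forall>p\<ge>p0. fiber_full p \<subseteq> fiber_part p"
  using pow_full_uniformly fiber_full_eventually by blast

lemma fiber_vars_eq: "fiber_vars = map (\<lambda>x. tmon x 0) (vars :: ('v, 'k) mpoly list)"
  by (simp add: fiber_vars_def tmon_def monom_0 to_fract_def)

lemma fiber_vars_zero: "0 \<notin> set (fiber_vars :: ('v, 'k) mpoly poly fract list)"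
  using zero_notin_vars[where 'v='v and 'k='k] by (auto simp: fiber_vars_eq)

lemma fiber_vars_length: "length (fiber_vars :: ('v, 'k) mpoly poly fract list) = card (UNIV :: 'v set)"
  by (simp add: fiber_vars_eq length_vars)

lemma fiber_vars_nth: "j < card (UNIV :: 'v set) \<Longrightarrow>
    fiber_vars ! j = tmon (Var (var_list ! j) :: ('v, 'k) mpoly) 0"
  by (simp add: fiber_vars_eq length_vars vars_nth)

lemma fiber_part_var: "x \<in> set fiber_vars \<Longrightarrow> z \<in> fiber_part n \<Longrightarrow> x * z \<in> fiber_part (n + 1)"
proof -
  assume "x \<in> set fiber_vars" "z \<in> fiber_part n"
  then obtain v a b e where x: "x = tmon (Var v) 0" and z: "z = tmon a e / tmon b e"
    "a \<in> pow_module e (n + int d * int e)" "b \<in> denom e"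
    unfolding fiber_ring_eq fiber_vars_eq by (auto simp: set_vars)
  have "Var v * a \<in> pow_module e (n + 1 + int d * int e)"
    using z(2) forms_mult[OF Var_forms, of a "n + int d * int e" v]
      ideal_pow_mult[of a I e "Var v"] by (simp add: ac_simps)
  moreover have "x * z = tmon (Var v * a) e / tmon b e" unfolding x z by (simp add: tmon_mult)
  ultimately show ?thesis using z(3) unfolding fiber_ring_eq by blast
qed

text \<open>
  A large power of the generator f outside P is a combination of N-th powers of variables; dividing
  by this power of f, which is a unit, writes one as such a combination.
\<close>
lemma fiber_vars_unit:
  obtains y where "\<forall>v. y v \<in> fiber_full (- int N)"
    "(\<Sum>v<card (UNIV :: 'v set). y v * (fiber_vars ! v) ^ N) = (1 :: ('v, 'k) mpoly poly fract)"
proof -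
  obtain f where f: "f \<in> F" "f \<in> denom 1" by (rule denom_generator)
  \<comment> \<open>The degree M d of the M-th power of f exceeds the pigeonhole bound for N-th powers.\<close>
  define M where "M = card (UNIV :: 'v set) * N + 1"
  have "f ^ M \<in> forms (int M * int d)" by (rule forms_power) (use f F_forms in auto)
  moreover have "int (card (UNIV :: 'v set)) * (int N - 1) < int M * int d"
  proof -
    have "int (card (UNIV :: 'v set)) * (int N - 1) < int M" by (simp add: M_def algebra_simps)
    also have "\<dots> \<le> int M * int d" using d_pos by (simp add: mult_le_cancel_left1)
    finally show ?thesis .
  qed
  ultimately obtain h where h: "\<forall>v. h v \<in> forms (int M * int d - int N)" "f ^ M = (\<Sum>v\<in>UNIV. Var v ^ N * h v)"
    by (rule forms_power_sum)
  have fM: "f ^ M \<in> denom M" using denom_power[OF f(2), of M] by simp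
  define y where "y v = tmon (h (var_list ! v)) M / tmon (f ^ M) M" for v
  have "y v \<in> fiber_full (- int N)" for v
    unfolding y_def fiber_full_def using h(1) fM
    by (intro CollectI exI[of _ "h (var_list ! v)"] exI[of _ "f ^ M"] exI[of _ M]) (simp add: algebra_simps)
  moreover have "(\<Sum>v<card (UNIV :: 'v set). y v * (fiber_vars ! v) ^ N) = 1"
  proof -
    have "(\<Sum>v<card (UNIV :: 'v set). y v * (fiber_vars ! v) ^ N)
        = (\<Sum>v<card (UNIV :: 'v set). tmon (Var (var_list ! v) ^ N * h (var_list ! v)) M) / tmon (f ^ M) M"
      unfolding sum_divide_distrib
      by (intro sum.cong refl) (simp add: y_def fiber_vars_nth tmon_power tmon_mult mult.commute)
    also have "(\<Sum>v<card (UNIV :: 'v set). tmon (Var (var_list ! v) ^ N * h (var_list ! v)) M)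
        = (\<Sum>w\<in>UNIV. tmon (Var w ^ N * h w) M)"
      by (rule sum.reindex_bij_betw[OF var_list_bij])
    also have "\<dots> = tmon (f ^ M) M" by (simp add: tmon_sum h(2))
    finally show ?thesis using denom_nonzero[OF fM] by simp
  qed
  ultimately show ?thesis using that by blast
qed

interpretation domain_embedding "\<lambda>z :: ('v, 'k) mpoly poly fract. z"
  by (rule field_embedding)

\<comment> \<open>For the identity embedding these rules rewrite terms to themselves.\<close>
declare \<iota>_eq_0 [simp del] \<iota>_zero [simp del]

text \<open>
  For the denominator exponent s, the relation 1 = sum of y v * (x v)^s splits a cocycle into the
  cocycles y v * (x v)^s * c.  The factor (x v)^s cancels the denominator of the cone over v at the
  vertex v, so the cone lies in the localization of T at the smaller index set.  For a nonempty index
  set this is the localization of the fibre ring, and for the empty one it is covered by the assumption.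
\<close>
lemma fiber_higher_vanishes:
  assumes full: "i = 0 \<Longrightarrow> fiber_full n \<subseteq> fiber_part n"
  shows "\<not> local_cohomology_nonzero fiber_vars fiber_part (Suc i) n"
proof (rule local_cohomology_Suc_vanishes[OF fiber_vars_zero])
  let ?V = "card (UNIV :: 'v set)"
  let ?xs = "fiber_vars :: ('v, 'k) mpoly poly fract list"
  fix c
  assume c: "\<forall>J\<in>cech_index ?xs (Suc i). c J \<in> loc fiber_part (cech_elem ?xs J) (Suc i) n"
    and cocycle: "\<forall>J\<in>cech_index ?xs (Suc (Suc i)). simplicial_diff c J = 0"
  obtain s m where m: "\<forall>J\<in>cech_index ?xs (Suc i). m J \<in> fiber_part (n + int s * int (Suc i))
      \<and> c J = m J / cech_elem ?xs J ^ s"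
    by (rule common_denominator[OF fiber_part_var fiber_vars_zero c])
  obtain y where y: "\<forall>v. y v \<in> fiber_full (- int s)" "(\<Sum>v<?V. y v * (?xs ! v) ^ s) = 1"
    by (rule fiber_vars_unit)
  define cv where "cv v J = y v * (?xs ! v) ^ s * c J" for v J
  have cv_cocycle: "simplicial_diff (cv v) J = 0" if "J \<in> cech_index ?xs (Suc (Suc i))" for v J
  proof -
    have "simplicial_diff (cv v) J = y v * (?xs ! v) ^ s * simplicial_diff c J"
      unfolding simplicial_diff_def cv_def sum_distrib_left by (intro sum.cong refl) (simp only: ac_simps)
    also have "simplicial_diff c J = 0" using cocycle that by blast
    finally show ?thesis by (simp only: mult_zero_right)
  qed
  have cv_sum: "(\<Sum>v<?V. cv v J) = c J" for J
    unfolding cv_def sum_distrib_right[symmetric] y(2) by (rule mult_1_left)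
  define b where "b J = (\<Sum>v<?V. cone v (cv v) J)" for J
  have b_eq: "b = (\<lambda>J. \<Sum>v<length ?xs. cone v (cv v) J)"
    by (rule ext) (simp only: b_def fiber_vars_length)
  have "simplicial_diff b J = c J" if J: "J \<in> cech_index ?xs (Suc i)" for J
  proof -
    have "simplicial_diff b J = (\<Sum>v<length ?xs. cv v J)"
      unfolding b_eq by (rule simplicial_diff_cone_sum[OF cv_cocycle J])
    also have "\<dots> = c J" unfolding fiber_vars_length by (rule cv_sum)
    finally show ?thesis .
  qed
  moreover have "b J \<in> loc fiber_part (cech_elem ?xs J) i n" if J: "J \<in> cech_index ?xs i" for J
  proof -
    let ?x = "cech_elem ?xs J"
    have x_nz: "?x \<noteq> 0" by (rule cech_elem_nonzero[OF fiber_vars_zero J])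
    have "\<exists>h. h \<in> fiber_full (n + int s * int i) \<and> cone v (cv v) J = h / ?x ^ s" if v: "v < ?V" for v
    proof (cases "v \<in> J")
      case True
      then show ?thesis by (intro exI[of _ 0]) (simp add: cone_def)
    next
      case False
      let ?J = "insert v J"
      have J': "?J \<in> cech_index ?xs (Suc i)" using cech_index_insert[OF J _ False] v by (simp add: fiber_vars_length)
      have "cech_elem ?xs ?J = ?xs ! v * ?x"
        using cech_elem_diff[OF J', of v] False by (simp add: mult.commute)
      moreover have "?xs ! v \<noteq> 0" using v by (simp add: fiber_vars_nth)
      ultimately have "cv v ?J = y v * m ?J / ?x ^ s"
        using m J' x_nz by (simp add: cv_def power_mult_distrib)
      then have "cone v (cv v) J = alt_sign ?J v * (y v * m ?J) / ?x ^ s" using False by (simp add: cone_def)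
      moreover have ym: "y v * m ?J \<in> fiber_full (n + int s * int i)"
      proof -
        have "m ?J \<in> fiber_full (n + int s * int (Suc i))" using m J' fiber_part_subset by blast
        from fiber_full_mult[OF y(1)[rule_format] this] show ?thesis by (simp add: algebra_simps)
      qed
      moreover have "alt_sign ?J v * (y v * m ?J) \<in> fiber_full (n + int s * int i)"
        using ym fiber_full_uminus[OF ym]
        by (cases "even (card {k \<in> ?J. k < v})") (simp_all add: alt_sign_def)
      ultimately show ?thesis by blast
    qed
    then obtain h where h: "\<forall>v<?V. h v \<in> fiber_full (n + int s * int i) \<and> cone v (cv v) J = h v / ?x ^ s"
      by metis
    define w where "w = (\<Sum>v<?V. h v)"
    have b: "b J = w / ?x ^ s"
      unfolding b_def w_def sum_divide_distrib using h by (intro sum.cong refl) auto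
    have w: "w \<in> fiber_full (n + int s * int i)" unfolding w_def using h by (intro fiber_full_sum) auto
    show ?thesis
    proof (cases "i = 0")
      case True
      then have "w \<in> fiber_part (n + int s * int i)" using w full by auto
      then show ?thesis unfolding b loc_def by blast
    next
      case False
      obtain p0 where p0: "\<forall>p\<ge>p0. fiber_full p \<subseteq> fiber_part p" using fiber_full_large by blast
      define t where "t = nat (p0 - (n + int s * int i))"
      have "?x = tmon (\<Prod>j\<in>J. vars ! j :: ('v, 'k) mpoly) 0"
      proof -
        have "(\<Prod>j\<in>K. ?xs ! j) = tmon (\<Prod>j\<in>K. vars ! j) 0" if "finite K" "K \<subseteq> {..<?V}" for K
          using that by (induction K) (simp_all add: tmon_one fiber_vars_nth vars_nth tmon_mult)
        then show ?thesis using cech_indexD[OF J] by (simp add: cech_elem_def fiber_vars_length)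
      qed
      moreover have "(\<Prod>j\<in>J. vars ! j :: ('v, 'k) mpoly) \<in> forms (int i)"
        using prod_vars_forms[of J, where 'v='v and 'k='k] cech_indexD[OF J]
        by (simp add: fiber_vars_length length_vars)
      ultimately have "?x \<in> fiber_full (int i)" using forms_fiber_full by metis
      then have "?x ^ t * w \<in> fiber_full (int t * int i + (n + int s * int i))"
        by (rule fiber_full_mult[OF fiber_full_power w])
      then have xw: "?x ^ t * w \<in> fiber_full (n + int (s + t) * int i)" by (simp add: algebra_simps)
      have "int t \<le> int t * int i" using False by (simp add: mult_le_cancel_left1)
      then have "p0 \<le> n + int (s + t) * int i" unfolding of_nat_add distrib_right t_def by linarith
      then have "?x ^ t * w \<in> fiber_part (n + int (s + t) * int i)" using p0 xw by blast
      moreover have "b J = (?x ^ t * w) / ?x ^ (s + t)" using x_nz unfolding b by (simp add: power_add)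
      ultimately show ?thesis unfolding loc_def by blast
    qed
  qed
  ultimately show "\<exists>b. (\<forall>J\<in>cech_index ?xs i. b J \<in> loc fiber_part (cech_elem ?xs J) i n) \<and>
      (\<forall>J\<in>cech_index ?xs (Suc i). simplicial_diff b J = c J)"
    by blast
qed

text \<open>
  The largest degree in which T and the fibre ring differ.  They differ in degree - d, where the
  inverse of a generator lives, so the restriction to degrees from - d on does not affect the maximum.
\<close>
definition fiber_end :: int where
  "fiber_end = Max {p. - int d \<le> p \<and> \<not> fiber_full p \<subseteq> fiber_part p}"

lemma fiber_end:
  shows "- int d \<le> fiber_end" "\<not> fiber_full fiber_end \<subseteq> fiber_part fiber_end"
    "p > fiber_end \<Longrightarrow> fiber_full p \<subseteq> fiber_part p"
proof -
  let ?S = "{p. - int d \<le> p \<and> \<not> fiber_full p \<subseteq> fiber_part p}"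
  obtain p0 where p0: "\<forall>p\<ge>p0. fiber_full p \<subseteq> fiber_part p" using fiber_full_large by blast
  have "?S \<subseteq> {- int d..p0}"
  proof
    fix p assume p: "p \<in> ?S"
    then have "\<not> p0 \<le> p" using p0 by blast
    then show "p \<in> {- int d..p0}" using p by simp
  qed
  then have fin: "finite ?S" using finite_subset by blast
  have "- int d \<in> ?S"
  proof -
    obtain f where f: "f \<in> denom 1" using denom_generator by blast
    have "tmon 1 1 / tmon f 1 \<in> fiber_full (- int d)"
      unfolding fiber_full_def using f forms_1
      by (intro CollectI exI[of _ 1] exI[of _ f] exI[of _ "1::nat"]) simp
    moreover have "tmon 1 1 / tmon f 1 \<notin> fiber_part (- int d)"
      using d_pos denom_nonzero[OF f] by (simp add: fiber_ring_def)
    ultimately show ?thesis by blast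
  qed
  then have "?S \<noteq> {}" by blast
  then have "fiber_end \<in> ?S" unfolding fiber_end_def using Max_in[OF fin] by blast
  then show e: "- int d \<le> fiber_end" "\<not> fiber_full fiber_end \<subseteq> fiber_part fiber_end" by auto
  show "fiber_full p \<subseteq> fiber_part p" if p: "p > fiber_end"
  proof (rule ccontr)
    assume "\<not> ?thesis"
    then have "p \<in> ?S" using p e(1) by auto
    then have "p \<le> fiber_end" unfolding fiber_end_def using Max_ge[OF fin] by blast
    then show False using p by simp
  qed
qed

lemma a_star_reg_fiber:
  "a_star fiber_vars fiber_part = ereal (real_of_int fiber_end)"
  "reg fiber_vars fiber_part = ereal (real_of_int fiber_end) + 1"
proof -
  have ne: "(fiber_vars :: ('v, 'k) mpoly poly fract list) \<noteq> []" using fiber_vars_length by auto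
  obtain z where z: "z \<in> fiber_full fiber_end" "z \<notin> fiber_part fiber_end" using fiber_end(2) by blast
  have nz: "local_cohomology_nonzero fiber_vars fiber_part 1 fiber_end"
  proof (rule local_cohomology_1_nonzero[of z _ _ _ 1])
    fix x :: "('v, 'k) mpoly poly fract" assume "x \<in> set fiber_vars"
    then have "x \<in> fiber_full 1" using forms_fiber_full[OF Var_forms] by (auto simp: fiber_vars_eq set_vars)
    then have "x * z \<in> fiber_full (fiber_end + 1)" using fiber_full_mult[OF _ z(1)] by (simp add: add.commute)
    then show "x ^ 1 * z \<in> fiber_part (fiber_end + int 1)" using fiber_end(3)[of "fiber_end + 1"] by auto
  next
    show "\<exists>x\<in>set (fiber_vars :: ('v, 'k) mpoly poly fract list). x \<noteq> 0"
      using hd_in_set[OF ne] fiber_vars_zero by (intro bexI[of _ "hd fiber_vars"]) auto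
  qed (use z in auto)
  have "n \<le> fiber_end \<and> n + int i \<le> fiber_end + 1"
    if nzi: "local_cohomology_nonzero fiber_vars fiber_part i n" for i n
  proof -
    obtain k where i: "i = Suc k" using local_cohomology_0_vanishes[OF fiber_vars_zero ne] nzi by (cases i) auto
    have k: "k = 0" "\<not> fiber_full n \<subseteq> fiber_part n" using fiber_higher_vanishes[of k n] nzi i by blast+
    then have "\<not> fiber_end < n" using fiber_end(3)[of n] by blast
    then show ?thesis using i k(1) by simp
  qed
  from a_star_reg_eq[OF nz this] show
    "a_star fiber_vars fiber_part = ereal (real_of_int fiber_end)"
    "reg fiber_vars fiber_part = ereal (real_of_int fiber_end) + 1" by auto
qed

text \<open>
  The assumption propagates from q to all larger exponents.  Every fraction can be expanded by a
  power of a generator outside P, which makes the exponent of its numerator at least q.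
\<close>
lemma fiber_full_if_pow_full:
  assumes q: "q > 0" "0 \<le> p + int d * int q" and full: "forms (p + int d * int q) \<subseteq> ideal_pow I q"
  shows "fiber_full p \<subseteq> fiber_part p"
proof
  have full': "forms (p + int d * int (q + r)) \<subseteq> ideal_pow I (q + r)" for r
  proof (induction r)
    case (Suc r)
    have nonneg: "0 \<le> p + int d * int (q + r)"
    proof -
      have "0 \<le> int d * int r" by simp
      then show ?thesis using q(2) unfolding of_nat_add distrib_left by linarith
    qed
    have "forms (p + int d * int (q + r) + int d) \<subseteq> ideal_pow I (q + r)"
      by (rule pow_full_mono[OF Suc nonneg]) simp
    also have "\<dots> \<subseteq> I" using pow_subset[of "q + r"] q(1) by auto
    finally have "forms (p + int d * int (q + r) + int d) \<subseteq> ideal_pow I (Suc (q + r))"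
      by (rule pow_full_step[OF Suc])
    moreover have "p + int d * int (q + r) + int d = p + int d * int (q + Suc r)"
      by (simp add: algebra_simps)
    ultimately show ?case by (simp only: add_Suc_right)
  qed (use full in simp)
  fix z assume "z \<in> fiber_full p"
  then obtain a b e where z: "z = tmon a e / tmon b e" "a \<in> forms (p + int d * int e)" "b \<in> denom e"
    unfolding fiber_full_def by blast
  obtain f where f: "f \<in> F" "f \<in> denom 1" by (rule denom_generator)
  have fq: "f ^ q \<in> denom q" using denom_power[OF f(2), of q] by simp
  have "a * f ^ q \<in> forms (p + int d * int (q + e))"
    using forms_mult[OF z(2), of "f ^ q" "int d * int q"] fq by (auto simp: denom_def algebra_simps)
  then have "a * f ^ q \<in> pow_module (e + q) (p + int d * int (e + q))"
    using full'[of e] by (auto simp: add.commute)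
  moreover have "z = tmon (a * f ^ q) (e + q) / tmon (b * f ^ q) (e + q)"
    unfolding z(1) tmon_mult[symmetric] using denom_nonzero[OF fq] by simp
  ultimately show "z \<in> fiber_part p" using denom_mult[OF z(3) fq] unfolding fiber_ring_eq by blast
qed

end

context equigenerated begin

section \<open>Homogeneous primes of the base\<close>

abbreviation base :: "('v, 'k) mpoly poly set" where
  "base \<equiv> rees_base d I"

lemma base_iff: "h \<in> base \<longleftrightarrow> (\<forall>q. coeff h q \<in> pow_module q (int d * int q))"
proof
  assume "\<forall>q. coeff h q \<in> pow_module q (int d * int q)"
  then show "h \<in> base" unfolding rees_base_def rees_nat by auto
qed (use base_coeff in blast)

lemma base_add: "g \<in> base \<Longrightarrow> h \<in> base \<Longrightarrow> g + h \<in> base"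
  by (auto simp: base_iff intro: ideal_pow_add forms_add)

lemma base_0: "0 \<in> base"
  by (auto simp: base_iff ideal_pow_zero)

lemma base_mult:
  assumes "g \<in> base" "h \<in> base" shows "g * h \<in> base"
  unfolding base_iff
proof
  fix q
  have "coeff g i * coeff h (q - i) \<in> pow_module q (int d * int q)" if "i \<le> q" for i
  proof -
    have "coeff g i * coeff h (q - i) \<in> pow_module (i + (q - i)) (int d * int i + int d * int (q - i))"
      using base_coeff[OF assms(1), of i] base_coeff[OF assms(2), of "q - i"]
      by (auto intro: pow_mult forms_mult)
    moreover have "int d * int i + int d * int (q - i) = int d * int q"
      using that by (simp add: of_nat_diff algebra_simps)
    ultimately show ?thesis using that by simp
  qed
  then show "coeff (g * h) q \<in> pow_module q (int d * int q)"
    unfolding coeff_mult by (auto intro: ideal_pow_sum forms_sum)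
qed

lemma base_const: "a \<in> forms 0 \<Longrightarrow> monom a 0 \<in> base"
  by (rule monom_in_base) (simp add: ideal_pow_0)

lemma base_part: "h \<in> base \<Longrightarrow> monom (coeff h q) q \<in> base"
  by (rule monom_in_base) (rule base_coeff)

definition homogeneous_ideal :: "('v, 'k) mpoly poly set \<Rightarrow> bool" where
  "homogeneous_ideal Q \<longleftrightarrow> Q \<subseteq> base \<and> 0 \<in> Q \<and> (\<forall>a\<in>Q. \<forall>b\<in>Q. a + b \<in> Q) \<and>
    (\<forall>a\<in>base. \<forall>b\<in>Q. a * b \<in> Q) \<and> (\<forall>h\<in>Q. \<forall>q. monom (coeff h q) q \<in> Q)"

lemma homogeneous_idealD:
  assumes "homogeneous_ideal Q"
  shows "Q \<subseteq> base" "0 \<in> Q" "a \<in> Q \<Longrightarrow> b \<in> Q \<Longrightarrow> a + b \<in> Q"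
    "c \<in> base \<Longrightarrow> b \<in> Q \<Longrightarrow> c * b \<in> Q" "h \<in> Q \<Longrightarrow> monom (coeff h q) q \<in> Q"
  using assms unfolding homogeneous_ideal_def by blast+

lemma homogeneous_ideal_sum:
  "homogeneous_ideal Q \<Longrightarrow> (\<And>x. x \<in> X \<Longrightarrow> f x \<in> Q) \<Longrightarrow> sum f X \<in> Q"
  by (induction X rule: infinite_finite_induct) (auto intro: homogeneous_idealD)

lemma homogeneous_ideal_diff:
  assumes "homogeneous_ideal Q" "a \<in> Q" "b \<in> Q" shows "a - b \<in> Q"
proof -
  have "monom (- 1) 0 \<in> base" by (intro base_const forms_uminus forms_1)
  then have "monom (- 1) 0 * b \<in> Q" using homogeneous_idealD(4)[OF assms(1)] assms(3) by blast
  moreover have "monom (- 1) 0 * b = - b" by (simp add: monom_0)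
  ultimately show ?thesis using homogeneous_idealD(3)[OF assms(1,2), of "- b"] by simp
qed

lemma homogeneous_ideal_extend:
  assumes Q: "homogeneous_ideal Q" and x: "monom a r \<in> base"
  shows "homogeneous_ideal {u + monom a r * w | u w. u \<in> Q \<and> w \<in> base}" (is "homogeneous_ideal ?E")
  unfolding homogeneous_ideal_def
proof (intro conjI ballI allI)
  note Q' = homogeneous_idealD[OF Q]
  show "?E \<subseteq> base" using Q'(1) x by (auto intro: base_add base_mult)
  show "0 \<in> ?E" using Q'(2) base_0 by (intro CollectI exI[of _ 0]) simp
  show "y + z \<in> ?E" if y: "y \<in> ?E" and z: "z \<in> ?E" for y z
  proof -
    obtain u w u' w' where uw: "y = u + monom a r * w" "u \<in> Q" "w \<in> base"
      "z = u' + monom a r * w'" "u' \<in> Q" "w' \<in> base" using y z by blast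
    have "y + z = (u + u') + monom a r * (w + w')" using uw by (simp add: algebra_simps)
    then show ?thesis using Q'(3)[OF uw(2,5)] base_add[OF uw(3,6)] by blast
  qed
  show "c * y \<in> ?E" if c: "c \<in> base" and y: "y \<in> ?E" for c y
  proof -
    obtain u w where uw: "y = u + monom a r * w" "u \<in> Q" "w \<in> base" using y by blast
    have "c * y = c * u + monom a r * (c * w)" using uw by (simp add: algebra_simps)
    then show ?thesis using Q'(4)[OF c uw(2)] base_mult[OF c uw(3)] by blast
  qed
  show "monom (coeff y q) q \<in> ?E" if y: "y \<in> ?E" for y q
  proof -
    obtain u w where uw: "y = u + monom a r * w" "u \<in> Q" "w \<in> base" using y by blast
    define w' where "w' = (if r \<le> q then monom (coeff w (q - r)) (q - r) else 0)"
    have "monom (coeff (monom a r * w) q) q = monom a r * w'"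
      by (simp add: w'_def coeff_monom_mult mult_monom)
    then have "monom (coeff y q) q = monom (coeff u q) q + monom a r * w'"
      unfolding uw(1) coeff_add by (simp add: add_monom[symmetric])
    moreover have "w' \<in> base" using base_part[OF uw(3)] base_0 by (simp add: w'_def)
    ultimately show ?thesis using Q'(5)[OF uw(2), of q] by blast
  qed
qed

text \<open>
  The lowest parts outside an ideal are the ones on which the primality of homogeneous ideals is
  tested.
\<close>
lemma homogeneous_part_notin:
  assumes "homogeneous_ideal Q" "h \<notin> Q"
  obtains r where "monom (coeff h r) r \<notin> Q" "\<forall>i<r. monom (coeff h i) i \<in> Q"
proof -
  have ex: "\<exists>r. monom (coeff h r) r \<notin> Q"
  proof (rule ccontr)
    assume "\<not> ?thesis"
    then have "(\<Sum>q\<le>degree h. monom (coeff h q) q) \<in> Q"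
      by (intro homogeneous_ideal_sum[OF assms(1)]) blast
    then show False using assms(2) by (simp add: poly_as_sum_of_monoms)
  qed
  show ?thesis
  proof (rule that[of "LEAST r. monom (coeff h r) r \<notin> Q"])
    show "monom (coeff h (LEAST r. monom (coeff h r) r \<notin> Q)) (LEAST r. monom (coeff h r) r \<notin> Q) \<notin> Q"
      using ex by (rule LeastI_ex)
  qed (use not_less_Least in blast)
qed

text \<open>
  A homogeneous ideal that is maximal among those avoiding all powers of f t is prime.  For
  homogeneous elements this is the usual argument; the general case follows by looking at the
  product of the lowest parts of two elements that are not in the ideal.
\<close>
lemma homogeneous_prime_exists:
  assumes A: "homogeneous_ideal A" and f: "f \<in> F" and fA: "\<And>N. monom (f ^ N) N \<notin> A"
  obtains P where "P \<in> Proj_base d I" "A \<subseteq> P" "monom f 1 \<notin> P"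
proof -
  define \<C> where "\<C> = {Q. homogeneous_ideal Q \<and> A \<subseteq> Q \<and> (\<forall>N. monom (f ^ N) N \<notin> Q)}"
  have "\<exists>M\<in>\<C>. \<forall>X\<in>\<C>. M \<subseteq> X \<longrightarrow> X = M"
  proof (rule subset_Zorn_nonempty)
    show "\<C> \<noteq> {}" using A fA unfolding \<C>_def by blast
    show "\<Union>C \<in> \<C>" if C: "C \<noteq> {}" "subset.chain \<C> C" for C
    proof -
      have sub: "C \<subseteq> \<C>" and total: "\<And>X Y. X \<in> C \<Longrightarrow> Y \<in> C \<Longrightarrow> X \<subseteq> Y \<or> Y \<subseteq> X"
        using C(2) by (auto simp: subset_chain_def)
      have hom: "homogeneous_ideal X" if "X \<in> C" for X using sub that by (auto simp: \<C>_def)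
      have "homogeneous_ideal (\<Union>C)"
        unfolding homogeneous_ideal_def
      proof (intro conjI ballI allI)
        show "\<Union>C \<subseteq> base" using homogeneous_idealD(1)[OF hom] by blast
        show "0 \<in> \<Union>C" using C(1) homogeneous_idealD(2)[OF hom] by blast
        show "x + y \<in> \<Union>C" if xy: "x \<in> \<Union>C" "y \<in> \<Union>C" for x y
        proof -
          obtain X Y where XY: "X \<in> C" "x \<in> X" "Y \<in> C" "y \<in> Y" using xy by blast
          then obtain Z where "Z \<in> C" "x \<in> Z" "y \<in> Z" using total[of X Y] by blast
          then show ?thesis using homogeneous_idealD(3)[OF hom] by blast
        qed
        show "c * y \<in> \<Union>C" if "c \<in> base" "y \<in> \<Union>C" for c y
          using that homogeneous_idealD(4)[OF hom] by blast
        show "monom (coeff h q) q \<in> \<Union>C" if "h \<in> \<Union>C" for h q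
          using that homogeneous_idealD(5)[OF hom] by blast
      qed
      moreover have "A \<subseteq> \<Union>C" using C(1) sub unfolding \<C>_def by blast
      moreover have "\<forall>N. monom (f ^ N) N \<notin> \<Union>C" using sub unfolding \<C>_def by blast
      ultimately show ?thesis unfolding \<C>_def by blast
    qed
  qed
  then obtain M where M: "M \<in> \<C>" and max: "\<And>X. X \<in> \<C> \<Longrightarrow> M \<subseteq> X \<Longrightarrow> X = M" by blast
  have hM: "homogeneous_ideal M" and AM: "A \<subseteq> M" and fM: "\<And>N. monom (f ^ N) N \<notin> M"
    using M unfolding \<C>_def by blast+
  note M' = homogeneous_idealD[OF hM]
  have power: "\<exists>N u w. monom (f ^ N) N = u + monom a r * w \<and> u \<in> M \<and> w \<in> base"
    if x: "monom a r \<in> base" "monom a r \<notin> M" for a r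
  proof (rule ccontr)
    assume no: "\<not> ?thesis"
    let ?E = "{u + monom a r * w | u w. u \<in> M \<and> w \<in> base}"
    have "M \<subseteq> ?E"
    proof
      fix u assume "u \<in> M"
      then show "u \<in> ?E" using base_0 by (intro CollectI exI[of _ u] exI[of _ 0]) simp
    qed
    moreover have "?E \<in> \<C>"
      using homogeneous_ideal_extend[OF hM x(1)] AM \<open>M \<subseteq> ?E\<close> no unfolding \<C>_def by blast
    ultimately have "?E = M" by (intro max)
    moreover have "monom a r \<in> ?E"
    proof -
      have "1 \<in> base" using base_const[OF forms_1] by (simp add: monom_0 flip: one_pCons)
      then show ?thesis using M'(2) by (intro CollectI exI[of _ 0] exI[of _ 1]) simp
    qed
    ultimately show False using x(2) by blast
  qed
  have prime_monom: "monom a r * monom b s \<notin> M"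
    if x: "monom a r \<in> base" "monom a r \<notin> M" and y: "monom b s \<in> base" "monom b s \<notin> M" for a r b s
  proof
    assume xy: "monom a r * monom b s \<in> M"
    obtain N u w where 1: "monom (f ^ N) N = u + monom a r * w" "u \<in> M" "w \<in> base" using power[OF x] by blast
    obtain N' u' w' where 2: "monom (f ^ N') N' = u' + monom b s * w'" "u' \<in> M" "w' \<in> base" using power[OF y] by blast
    have "monom (f ^ (N + N')) (N + N') = monom (f ^ N) N * monom (f ^ N') N'"
      by (simp add: mult_monom power_add)
    also have "\<dots> = (u' + monom b s * w') * u + (monom a r * w) * u' + (w * w') * (monom a r * monom b s)"
      unfolding 1(1) 2(1) by (simp add: algebra_simps)
    also have "\<dots> \<in> M"
    proof (intro M'(3))
      show "(u' + monom b s * w') * u \<in> M"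
        using 1 2 y(1) M'(1) by (intro M'(4) base_add base_mult) auto
      show "monom a r * w * u' \<in> M" using 1 2 x(1) by (intro M'(4) base_mult) auto
      show "w * w' * (monom a r * monom b s) \<in> M" using 1 2 xy by (intro M'(4)[OF _ xy] base_mult) auto
    qed
    finally show False using fM by blast
  qed
  have prime: "g \<in> M \<or> h \<in> M" if gh: "g \<in> base" "h \<in> base" "g * h \<in> M" for g h
  proof (rule ccontr)
    assume "\<not> ?thesis"
    then have "g \<notin> M" "h \<notin> M" by auto
    obtain r where r: "monom (coeff g r) r \<notin> M" "\<forall>i<r. monom (coeff g i) i \<in> M"
      using homogeneous_part_notin[OF hM \<open>g \<notin> M\<close>] by blast
    obtain s where s: "monom (coeff h s) s \<notin> M" "\<forall>i<s. monom (coeff h i) i \<in> M"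
      using homogeneous_part_notin[OF hM \<open>h \<notin> M\<close>] by blast
    define t where "t i = monom (coeff g i) i * monom (coeff h (r + s - i)) (r + s - i)" for i
    have t: "t i = monom (coeff g i * coeff h (r + s - i)) (r + s)" if "i \<le> r + s" for i
      using that by (simp add: t_def mult_monom)
    have "(\<Sum>i\<le>r + s. t i) = monom (coeff (g * h) (r + s)) (r + s)"
      unfolding coeff_mult monom_sum by (intro sum.cong refl t) auto
    then have total: "(\<Sum>i\<le>r + s. t i) \<in> M" using M'(5)[OF gh(3)] by simp
    have rest: "t i \<in> M" if i: "i \<in> {..r + s} - {r}" for i
    proof (cases "i < r")
      case True
      have "monom (coeff h (r + s - i)) (r + s - i) * monom (coeff g i) i \<in> M"
        using base_part[OF gh(2)] r(2)[rule_format, OF True] by (rule M'(4))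
      then show ?thesis by (simp add: t_def mult.commute)
    next
      case False
      then have "r + s - i < s" using i by auto
      then show ?thesis unfolding t_def using base_part[OF gh(1)] s(2) by (intro M'(4)) auto
    qed
    have rest_sum: "(\<Sum>i\<in>{..r + s} - {r}. t i) \<in> M" by (rule homogeneous_ideal_sum[OF hM rest])
    moreover have "(\<Sum>i\<le>r + s. t i) = t r + (\<Sum>i\<in>{..r + s} - {r}. t i)"
      by (rule sum.remove) auto
    ultimately have "t r \<in> M" using homogeneous_ideal_diff[OF hM total rest_sum] by simp
    then show False
      using prime_monom[OF base_part[OF gh(1)] r(1) base_part[OF gh(2)] s(1)] by (simp add: t_def)
  qed
  have f1: "monom f 1 \<in> base" using F_forms generator_mem[OF f] pow_1 f by (intro monom_in_base) auto
  have "M \<noteq> base"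
    using fM[of 0] base_const[OF forms_1] by auto
  moreover have "\<not> {h \<in> base. coeff h 0 = 0} \<subseteq> M"
  proof
    assume "{h \<in> base. coeff h 0 = 0} \<subseteq> M"
    then have "monom f 1 \<in> M" using f1 by auto
    then show False using fM[of 1] by simp
  qed
  ultimately have "M \<in> Proj_base d I"
    unfolding Proj_base_def Let_def using hM prime unfolding homogeneous_ideal_def by simp
  then show ?thesis using that AM fM[of 1] by simp
qed

section \<open>Comparison of the powers with the fibres\<close>

lemma fiberI: "P \<in> Proj_base d I \<Longrightarrow> fiber F I d P"
  by (intro fiber.intro fiber_axioms.intro equigenerated_axioms)

lemma F_nonzero: obtains f where "f \<in> F" "f \<noteq> 0"
proof -
  have "\<exists>f\<in>F. f \<noteq> 0"
  proof (rule ccontr)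
    assume "\<not> ?thesis"
    then have "ideal_gen F \<subseteq> {0}" by (intro ideal_gen_minimal) auto
    moreover obtain N where "Var undefined ^ N \<in> I" using Var_power_mem by blast
    ultimately have "Var (undefined :: 'v) ^ N = (0 :: ('v, 'k) mpoly)" unfolding I_def by blast
    then show False by simp
  qed
  then show ?thesis using that by blast
qed

lemma Proj_base_nonempty: "Proj_base d I \<noteq> {}"
proof -
  obtain f where f: "f \<in> F" "f \<noteq> 0" by (rule F_nonzero)
  have "homogeneous_ideal {0}" by (simp add: homogeneous_ideal_def base_0)
  moreover have "\<And>N. monom (f ^ N) N \<notin> {0}" using f(2) by simp
  ultimately show ?thesis using homogeneous_prime_exists[OF _ f(1)] by blast
qed

text \<open>
  Otherwise a homogeneous prime P of B contains the annihilator of the class of g t^q but not f t.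
  On the fibre at P the fraction g / f^q has a numerator in a power of I, and the denominator of
  that fraction annihilates the class although it lies outside P.
\<close>
lemma torsion_if_fibers_full:
  assumes full: "\<And>P. P \<in> Proj_base d I \<Longrightarrow> fiber.fiber_full I d P p \<subseteq> fiber_ring d I P p"
    and g: "g \<in> forms (p + int d * int q)" and f: "f \<in> F"
  shows "\<exists>N. f ^ N * g \<in> ideal_pow I (q + N)"
proof (rule ccontr)
  assume "\<not> ?thesis"
  then have no: "f ^ N * g \<notin> ideal_pow I (q + N)" for N by blast
  define A where "A = {h \<in> base. \<forall>e. coeff h e * g \<in> ideal_pow I (q + e)}"
  have "homogeneous_ideal A"
    unfolding homogeneous_ideal_def
  proof (intro conjI ballI allI)
    show "x + y \<in> A" if "x \<in> A" "y \<in> A" for x y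
      using that by (auto simp: A_def base_add distrib_right intro: ideal_pow_add)
    show "c * y \<in> A" if c: "c \<in> base" and y: "y \<in> A" for c y
    proof -
      have "coeff (c * y) e * g \<in> ideal_pow I (q + e)" for e
        unfolding coeff_mult sum_distrib_right
      proof (rule ideal_pow_sum)
        fix i assume i: "i \<in> {..e}"
        have "coeff c i * (coeff y (e - i) * g) \<in> ideal_pow I (i + (q + (e - i)))"
          using base_coeff[OF c, of i] y unfolding A_def
          by (intro pow_mult[of "coeff c i" i "coeff y (e - i) * g" "q + (e - i)"]) auto
        then show "coeff c i * coeff y (e - i) * g \<in> ideal_pow I (q + e)"
          using i by (simp add: mult.assoc add.left_commute)
      qed
      then show ?thesis using c y by (simp add: A_def base_mult)
    qed
    show "monom (coeff h k) k \<in> A" if "h \<in> A" for h k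
      using that by (auto simp: A_def base_part ideal_pow_zero)
  qed (auto simp: A_def base_0 ideal_pow_zero)
  moreover have "monom (f ^ N) N \<notin> A" for N
  proof
    assume "monom (f ^ N) N \<in> A"
    then have "coeff (monom (f ^ N) N) N * g \<in> ideal_pow I (q + N)" unfolding A_def by blast
    then show False using no[of N] by simp
  qed
  ultimately obtain P where prime: "P \<in> Proj_base d I" "A \<subseteq> P" "monom f 1 \<notin> P"
    using homogeneous_prime_exists[OF _ f] by blast
  interpret fiber F I d P by (rule fiberI[OF prime(1)])
  have "f \<in> denom 1" using prime(3) F_forms f generator_mem pow_1 by (auto simp: denom_def)
  then have fq: "f ^ q \<in> denom q" using denom_power[of f 1 q] by simp
  then have "tmon g q / tmon (f ^ q) q \<in> fiber_full p" using g unfolding fiber_full_def by blast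
  then have "tmon g q / tmon (f ^ q) q \<in> fiber_part p" using full[OF prime(1)] by blast
  then obtain a b e where ab: "tmon g q / tmon (f ^ q) q = tmon a e / tmon b e"
    "a \<in> pow_module e (p + int d * int e)" "b \<in> denom e"
    unfolding fiber_ring_eq by blast
  have "tmon g q * tmon b e = tmon a e * tmon (f ^ q) q"
    using ab(1) denom_nonzero[OF fq] denom_nonzero[OF ab(3)] by (simp add: frac_eq_eq)
  then have "b * g = f ^ q * a" by (simp add: tmon_mult add.commute mult.commute)
  moreover have "f ^ q * a \<in> ideal_pow I (q + e)"
    using ideal_pow_power[OF generator_mem[OF f]] ab(2) by (intro pow_mult) auto
  ultimately have "monom b e \<in> A"
    using ab(3) monom_in_base[of b e] by (auto simp: A_def denom_def ideal_pow_zero)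
  then show False using prime(2) ab(3) unfolding denom_def by blast
qed

text \<open>
  A form g outside I^q would give the nonzero class g t^q in H^1 of the module R_(p,*) in degree q.
\<close>
lemma pow_full_if_fibers_full:
  assumes fs: "set fs = F" and q: "q > 0" "ereal (real q) > a_star_rees fs d I p"
    and full: "\<And>P. P \<in> Proj_base d I \<Longrightarrow> fiber.fiber_full I d P p \<subseteq> fiber_ring d I P p"
  shows "forms (p + int d * int q) \<subseteq> ideal_pow I q"
proof (rule ccontr)
  interpret domain_embedding "to_fract :: ('v, 'k) mpoly poly \<Rightarrow> _" by (rule to_fract_embedding)
  assume "\<not> ?thesis"
  then obtain g where g: "g \<in> forms (p + int d * int q)" "g \<notin> ideal_pow I q" by blast
  obtain n where n: "f ^ n f * g \<in> ideal_pow I (q + n f)" if "f \<in> F" for f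
    using torsion_if_fibers_full[OF full g(1)] by metis
  \<comment> \<open>One exponent that works for all generators.\<close>
  define N where "N = (\<Sum>f\<in>F. n f)"
  let ?xs = "map (\<lambda>f. monom f 1) fs"
  have "local_cohomology_nonzero ?xs (rees d I p) 1 (int q)"
  proof (rule local_cohomology_1_nonzero[of "monom g q" _ _ _ N])
    show "monom g q \<notin> rees d I p (int q)" using g(2) by (auto simp: rees_nat)
    show "\<exists>x\<in>set ?xs. x \<noteq> 0" using F_nonzero fs by (metis (no_types, lifting) image_eqI list.set_map monom_eq_0_iff)
    fix x assume "x \<in> set ?xs"
    then obtain f where f: "f \<in> F" "x = monom f 1" using fs by auto
    have "n f \<le> N" unfolding N_def using f(1) F_finite by (simp add: member_le_sum)
    then have fN: "f ^ N * g = f ^ (N - n f) * (f ^ n f * g)" "q + N = (N - n f) + (q + n f)"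
      by (simp_all flip: power_add mult.assoc)
    have "f ^ N * g \<in> ideal_pow I (q + N)"
      unfolding fN using n[OF f(1)] ideal_pow_power[OF generator_mem[OF f(1)]]
      by (intro pow_mult[of "f ^ (N - n f)" "N - n f" "f ^ n f * g" "q + n f"])
    moreover have "f ^ N * g \<in> forms (int N * int d + (p + int d * int q))"
      using f(1) F_forms by (intro forms_mult forms_power g(1)) auto
    ultimately have "f ^ N * g \<in> pow_module (q + N) (p + int d * int (q + N))"
      by (simp add: algebra_simps)
    moreover have "x ^ N * monom g q = monom (f ^ N * g) (q + N)"
      unfolding f(2) by (simp add: monom_power mult_monom add.commute)
    ultimately have "x ^ N * monom g q \<in> rees d I p (int (q + N))" unfolding rees_nat by blast
    then show "x ^ N * monom g q \<in> rees d I p (int q + int N)" by simp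
  qed
  then have "ereal (real_of_int (int q)) \<le> a_inv ?xs (rees d I p) 1"
    unfolding a_inv_def by (intro SUP_upper) simp
  also have "\<dots> \<le> a_star ?xs (rees d I p)" unfolding a_star_def by (rule SUP_upper) simp
  finally show False using q(2) unfolding a_star_rees_def by simp
qed

text \<open>
  The ends of the fibres lie between - d and a common upper bound, so their supremum is attained on
  some fibre, and failure of T = R there forces the lower bound for the powers.
\<close>
lemma a_star_reg_phi:
  obtains \<alpha> where "a_star_phi d I = ereal (real_of_int \<alpha>)" "reg_phi d I = ereal (real_of_int \<alpha>) + 1"
    "\<And>P p. P \<in> Proj_base d I \<Longrightarrow> p > \<alpha> \<Longrightarrow> fiber.fiber_full I d P p \<subseteq> fiber_ring d I P p"
    "\<And>q. q > 0 \<Longrightarrow> pow_end q \<ge> \<alpha> + int d * int q" "- int d \<le> \<alpha>"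
proof -
  let ?e = "\<lambda>P. fiber.fiber_end I d P"
  obtain p0 where p0: "\<forall>q n. n \<ge> p0 + int d * int q \<longrightarrow> forms n \<subseteq> ideal_pow I q"
    using pow_full_uniformly by blast
  have bounds: "- int d \<le> ?e P \<and> ?e P \<le> p0" if P: "P \<in> Proj_base d I" for P
    using fiber.fiber_end(1,2)[OF fiberI[OF P]] fiber.fiber_full_eventually[OF fiberI[OF P] p0]
    by (metis linorder_linear)
  have "?e ` Proj_base d I \<subseteq> {- int d..p0}" using bounds by auto
  then have fin: "finite (?e ` Proj_base d I)" using finite_subset by blast
  define \<alpha> where "\<alpha> = Max (?e ` Proj_base d I)"
  have "\<alpha> \<in> ?e ` Proj_base d I" unfolding \<alpha>_def using Proj_base_nonempty fin by (intro Max_in) auto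
  then obtain P0 where P0: "P0 \<in> Proj_base d I" "\<alpha> = ?e P0" by blast
  have le: "?e P \<le> \<alpha>" if "P \<in> Proj_base d I" for P unfolding \<alpha>_def using fin that by simp
  show ?thesis
  proof (rule that)
    show "a_star_phi d I = ereal (real_of_int \<alpha>)"
      unfolding a_star_phi_def
    proof (rule antisym)
      show "(SUP P\<in>Proj_base d I. cech.a_star (*) fiber_vars (fiber_ring d I P)) \<le> ereal (real_of_int \<alpha>)"
        using fiber.a_star_reg_fiber(1)[OF fiberI] le by (intro SUP_least) simp
      show "ereal (real_of_int \<alpha>) \<le> (SUP P\<in>Proj_base d I. cech.a_star (*) fiber_vars (fiber_ring d I P))"
        using fiber.a_star_reg_fiber(1)[OF fiberI[OF P0(1)]] P0(2) by (intro SUP_upper2[OF P0(1)]) simp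
    qed
    show "reg_phi d I = ereal (real_of_int \<alpha>) + 1"
      unfolding reg_phi_def
    proof (rule antisym)
      show "(SUP P\<in>Proj_base d I. cech.reg (*) fiber_vars (fiber_ring d I P)) \<le> ereal (real_of_int \<alpha>) + 1"
        using fiber.a_star_reg_fiber(2)[OF fiberI] le
        by (intro SUP_least) (simp add: add_right_mono)
      show "ereal (real_of_int \<alpha>) + 1 \<le> (SUP P\<in>Proj_base d I. cech.reg (*) fiber_vars (fiber_ring d I P))"
        using fiber.a_star_reg_fiber(2)[OF fiberI[OF P0(1)]] P0(2) by (intro SUP_upper2[OF P0(1)]) simp
    qed
    show "fiber.fiber_full I d P p \<subseteq> fiber_ring d I P p" if "P \<in> Proj_base d I" "p > \<alpha>" for P p
      using fiber.fiber_end(3)[OF fiberI[OF that(1)]] le[OF that(1)] that(2) by simp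
    show "- int d \<le> \<alpha>" using bounds[OF P0(1)] P0(2) by simp
    show "pow_end q \<ge> \<alpha> + int d * int q" if q: "q > 0" for q
    proof (rule ccontr)
      assume "\<not> ?thesis"
      then have "forms (\<alpha> + int d * int q) \<subseteq> ideal_pow I q" by (intro pow_end(3)[OF q]) simp
      moreover have "0 \<le> \<alpha> + int d * int q"
      proof -
        have "int d * 1 \<le> int d * int q" using q by (intro mult_left_mono) auto
        then show ?thesis using bounds[OF P0(1)] P0(2) by simp
      qed
      ultimately show False
        using fiber.fiber_full_if_pow_full[OF fiberI[OF P0(1)] q] fiber.fiber_end(2)[OF fiberI[OF P0(1)]] P0(2)
        by simp
    qed
  qed
qed

end

theorem corollary4p9:
  fixes fs :: "('v::{finite,linorder}, 'k::field) mpoly list"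
    and I :: "('v, 'k) mpoly set"
    and d :: nat
  assumes "d > 0"
    and "set fs \<subseteq> forms (int d)"
    and "I = ideal_gen (set fs)"
    and "m_primary I"
  shows "\<exists>\<alpha>::int. a_star_phi d I = ereal (real_of_int \<alpha>) \<and>
     (\<forall>q\<ge>1. ereal (real q) > a_star_rees fs d I (\<alpha> + 1) \<longrightarrow>
        a_star_pow I q = ereal (real (d * q)) + a_star_phi d I \<and>
        reg_pow I q = ereal (real (d * q)) + reg_phi d I) \<and>
     stab_reg d I = stab_a d I \<and>
     ereal_of_enat (stab_a d I) \<le> max 1 (a_star_rees fs d I (\<alpha> + 1) + 1)"
proof -
  have "Var v \<in> ideal_radical I" for v
    using assms(4) unfolding m_primary_def max_ideal_def by (auto intro: ideal_gen_base)
  then interpret equigenerated "set fs" I d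
    using assms by unfold_locales (auto simp: ideal_radical_def)
  obtain \<alpha> where \<alpha>: "a_star_phi d I = ereal (real_of_int \<alpha>)" "reg_phi d I = ereal (real_of_int \<alpha>) + 1"
    and full: "\<And>P p. P \<in> Proj_base d I \<Longrightarrow> p > \<alpha> \<Longrightarrow> fiber.fiber_full I d P p \<subseteq> fiber_ring d I P p"
    and lower: "\<And>q. q > 0 \<Longrightarrow> pow_end q \<ge> \<alpha> + int d * int q" and \<alpha>_ge: "- int d \<le> \<alpha>"
    using a_star_reg_phi by blast
  have a_iff: "a_star_pow I q = ereal (real (d * q)) + a_star_phi d I \<longleftrightarrow> pow_end q = \<alpha> + int d * int q"
    if "q \<ge> 1" for q
  proof -
    have "a_star_pow I q = ereal (real (d * q)) + a_star_phi d I
        \<longleftrightarrow> real_of_int (pow_end q) = real_of_int (\<alpha> + int d * int q)"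
      using that by (simp add: a_star_reg_pow(1) \<alpha> add.commute)
    then show ?thesis by (simp only: of_int_eq_iff)
  qed
  have reg_iff: "reg_pow I q = ereal (real (d * q)) + reg_phi d I \<longleftrightarrow> pow_end q = \<alpha> + int d * int q"
    if "q \<ge> 1" for q
  proof -
    have "reg_pow I q = ereal (real (d * q)) + reg_phi d I
        \<longleftrightarrow> real_of_int (pow_end q) = real_of_int (\<alpha> + int d * int q)"
      using that by (auto simp: a_star_reg_pow(2) \<alpha> one_ereal_def)
    then show ?thesis by (simp only: of_int_eq_iff)
  qed
  let ?a = "a_star_rees fs d I (\<alpha> + 1)"
  have attained: "pow_end q = \<alpha> + int d * int q" if q: "q \<ge> 1" "ereal (real q) > ?a" for q
  proof (rule antisym)
    have q0: "q > 0" using q(1) by simp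
    show "pow_end q \<le> \<alpha> + int d * int q"
    proof (rule ccontr)
      assume no: "\<not> ?thesis"
      have "forms (\<alpha> + 1 + int d * int q) \<subseteq> ideal_pow I q"
        using pow_full_if_fibers_full[OF refl q0 q(2)] full by simp
      moreover have "0 \<le> \<alpha> + 1 + int d * int q"
      proof -
        have "int d * 1 \<le> int d * int q" using q(1) by (intro mult_left_mono) auto
        then show ?thesis using \<alpha>_ge by simp
      qed
      moreover have "\<alpha> + 1 + int d * int q \<le> pow_end q" using no by simp
      ultimately have "forms (pow_end q) \<subseteq> ideal_pow I q" by (rule pow_full_mono)
      then show False using pow_end(2)[OF q0] by blast
    qed
    show "\<alpha> + int d * int q \<le> pow_end q" by (rule lower[OF q0])
  qed
  have stab: "stab_reg d I = stab_a d I"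
    unfolding stab_reg_def stab_a_def using a_iff reg_iff
    by (intro arg_cong[of _ _ Inf] Collect_cong ex_cong1 conj_cong refl) (meson order_trans)
  have bound: "ereal_of_enat (stab_a d I) \<le> ereal (real Q)" if Q: "Q \<ge> 1" "ereal (real Q) > ?a" for Q
  proof -
    have "a_star_pow I q = ereal (real (d * q)) + a_star_phi d I" if "q \<ge> Q" for q
    proof -
      have "?a < ereal (real q)" using Q(2) that by (auto intro: less_le_trans)
      then show ?thesis using a_iff attained that Q(1) by simp
    qed
    then have "stab_a d I \<le> enat Q" unfolding stab_a_def using Q(1) by (intro Inf_lower) auto
    then show ?thesis by (metis ereal_of_enat_le_iff ereal_of_enat_simps(1))
  qed
  have "ereal_of_enat (stab_a d I) \<le> max 1 (?a + 1)"
  proof (cases ?a)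
    case (real r)
    \<comment> \<open>The least admissible exponent that is larger than the a-invariant r.\<close>
    define Q where "Q = nat (max 1 (\<lfloor>r\<rfloor> + 1))"
    have "real Q = max 1 (real_of_int \<lfloor>r\<rfloor> + 1)" by (simp add: Q_def max_def)
    moreover have "Q \<ge> 1" by (simp add: Q_def)
    moreover have "r < real_of_int \<lfloor>r\<rfloor> + 1" "real_of_int \<lfloor>r\<rfloor> \<le> r" by linarith+
    ultimately have "r < real Q" "real Q \<le> max 1 (r + 1)" by linarith+
    then have "ereal (real Q) \<le> max 1 (?a + 1)"
      using real by (auto simp: one_ereal_def max_def split: if_splits)
    moreover have "ereal_of_enat (stab_a d I) \<le> ereal (real Q)"
      using bound[OF \<open>Q \<ge> 1\<close>] \<open>r < real Q\<close> real by simp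
    ultimately show ?thesis by (rule order_trans[rotated])
  next
    case MInf
    then have "ereal_of_enat (stab_a d I) \<le> ereal (real 1)" by (intro bound) auto
    then show ?thesis by (simp add: one_ereal_def max.coboundedI1)
  qed simp
  then show ?thesis using \<alpha>(1) stab a_iff reg_iff attained by (intro exI[of _ \<alpha>]) blast
qed

end
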